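(* $\mathrm{ord}(\mathcal{K}_2^{\mathrm{eff}}) = \omega_1^{CK}$.
   Context: For a partial combinatory algebra (pca) $\mathcal{A}$, closed terms are built from elements by application (associating to the left), and $s\simeq t$ means both undefined or both defined and equal. Relations $\sim_\alpha$ on closed terms: $s\sim_0 t$ iff $s\simeq t$; $s \sim_{\alpha+1} t$ iff $sx \sim_\alpha tx$ for all $x\in\mathcal{A}$; for limit $\alpha$, $s\sim_\alpha t$ iff $s\sim_\beta t$ for some $\beta<\alpha$. $\mathrm{ord}(\mathcal{A})$ is the least ordinal $\alpha$ such that $\sim_\alpha$ equals $\sim_{\alpha+1}$. Kleene's second model $\mathcal{K}_2$ is the pca on Baire space $\omega^\omega$ where $f\cdot g$ is the result of applying the partial continuous functional coded by $f$ (Kleene's standard coding) to $g$. $\mathcal{K}_2^{\mathrm{eff}}$ is the pca obtained by restricting $\mathcal{K}_2$ to the total computable functions $f\in\omega^\omega$ (with the same application). $\omega_1^{CK}$ is the least non-computable ordinal. *)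

theory Defs
  imports "HOL-Library.Nat_Bijection" "HOL-Library.Infinite_Typeclass"
begin

section \<open>Ordinals\<close>

text \<open>
  An element of \<open>'o ordinal\<close> is the order type of a (reflexive) well-order on some subset of
  \<open>'o\<close>. For infinite \<open>'o\<close> these are exactly the ordinals of cardinality at most
  \<open>|'o|\<close>, and there is no largest one.
\<close>

quotient_type 'o ordinal = "'o rel" / partial: "\<lambda>r s. (r, s) \<in> ordIso"
proof (rule part_equivpI)
  have "({}, {}) \<in> (ordIso :: ('o rel \<times> 'o rel) set)"
    by (intro ordIso_reflexive) simp
  then show "\<exists>r. (r, r) \<in> (ordIso :: ('o rel \<times> 'o rel) set)" by blast
qed (blast intro: sympI transpI ordIso_symmetric ordIso_transitive)+

instantiation ordinal :: (type) wellorder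
begin

lift_definition less_eq_ordinal :: "'o ordinal \<Rightarrow> 'o ordinal \<Rightarrow> bool"
  is "\<lambda>r s. (r, s) \<in> ordLeq"
  by (meson ordIso_ordLeq_trans ordIso_symmetric ordLeq_ordIso_trans)

lift_definition less_ordinal :: "'o ordinal \<Rightarrow> 'o ordinal \<Rightarrow> bool"
  is "\<lambda>r s. (r, s) \<in> ordLess"
  by (meson ordIso_ordLess_trans ordIso_symmetric ordLess_ordIso_trans)

lemma ordIso_self_Well_order: "(r, r) \<in> ordIso \<longleftrightarrow> Well_order r"
  using ordIso_reflexive by (auto simp: ordIso_def)

instance
proof
  fix \<alpha> \<beta> \<gamma> :: "'o ordinal"
  show "\<alpha> < \<beta> \<longleftrightarrow> \<alpha> \<le> \<beta> \<and> \<not> \<beta> \<le> \<alpha>"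
    by transfer
      (metis ordIso_self_Well_order not_ordLeq_iff_ordLess not_ordLess_iff_ordLeq ordLess_imp_ordLeq)
  show "\<alpha> \<le> \<alpha>"
    by transfer (simp add: ordIso_self_Well_order ordLeq_reflexive)
  show "\<alpha> \<le> \<beta> \<Longrightarrow> \<beta> \<le> \<gamma> \<Longrightarrow> \<alpha> \<le> \<gamma>"
    by transfer (rule ordLeq_transitive)
  show "\<alpha> \<le> \<beta> \<Longrightarrow> \<beta> \<le> \<alpha> \<Longrightarrow> \<alpha> = \<beta>"
    by transfer (simp add: ordIso_iff_ordLeq)
  show "\<alpha> \<le> \<beta> \<or> \<beta> \<le> \<alpha>"
    by transfer (simp add: ordIso_self_Well_order ordLeq_total)
next
  fix P :: "'o ordinal \<Rightarrow> bool" and \<alpha> :: "'o ordinal"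
  assume step: "\<And>\<alpha>. (\<And>\<beta>. \<beta> < \<alpha> \<Longrightarrow> P \<beta>) \<Longrightarrow> P \<alpha>"
  have "(r, r) \<in> ordIso \<longrightarrow> P (abs_ordinal r)" for r :: "'o rel"
  proof (induction r rule: wf_induct[OF wf_ordLess])
    case (1 r)
    show ?case
    proof
      assume r: "(r, r) \<in> ordIso"
      show "P (abs_ordinal r)"
      proof (rule step)
        fix \<beta> :: "'o ordinal"
        assume less: "\<beta> < abs_ordinal r"
        obtain s where s: "(s, s) \<in> ordIso" "\<beta> = abs_ordinal s"
          using Quotient_abs_rep[OF Quotient_ordinal] Quotient_rep_reflp[OF Quotient_ordinal]
          by metis
        with less r have "(s, r) \<in> ordLess"
          by (simp add: less_ordinal.abs_eq eq_onp_def)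
        with 1 s show "P \<beta>" by blast
      qed
    qed
  qed
  then show "P \<alpha>"
    using Quotient_abs_rep[OF Quotient_ordinal] Quotient_rep_reflp[OF Quotient_ordinal] by metis
qed

end

instantiation ordinal :: (type) zero
begin

lift_definition zero_ordinal :: "'o ordinal" is "{}"
  by (intro ordIso_reflexive) simp

instance ..

end

lemma zero_ordinal_le: "0 \<le> (\<alpha> :: 'o ordinal)"
proof (transfer)
  fix r :: "'o rel"
  assume "(r, r) \<in> ordIso"
  then have r: "Well_order r" by (simp add: ordIso_self_Well_order)
  have e: "Well_order ({} :: 'o rel)" by simp
  show "({} :: 'o rel, r) \<in> ordLeq"
  proof (rule ccontr)
    assume "({} :: 'o rel, r) \<notin> ordLeq"
    then have "(r, {} :: 'o rel) \<in> ordLess"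
      using not_ordLeq_iff_ordLess[OF r e] by simp
    then show False
      using ordLess_iff_ordIso_Restr[OF e r] by simp
  qed
qed

lemma ex_ordinal_gt: "\<exists>\<beta>. (\<alpha> :: 'o::infinite ordinal) < \<beta>"
proof transfer
  fix r :: "'o rel"
  assume "(r, r) \<in> ordIso"
  then have r: "Well_order r" by (simp add: ordIso_self_Well_order)
  obtain a :: 'o where True by simp
  obtain f :: "'o \<Rightarrow> 'o" where f: "bij_betw f UNIV (UNIV - {a})"
    using infinite_imp_bij_betw[OF infinite_UNIV] by blast
  define p where "p = dir_image r f"
  have inj: "inj_on f (Field r)"
    using f by (meson bij_betw_def inj_on_subset subset_UNIV)
  have rp: "(r, p) \<in> ordIso"
    unfolding p_def using dir_image_ordIso[OF r inj] .
  then have p: "Well_order p" by (simp add: ordIso_def)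
  have a: "a \<notin> Field p"
    using f unfolding p_def by (auto simp: dir_image_Field bij_betw_def)
  define s where "s = p \<union> insert a (Field p) \<times> {a}"
  have Fs: "Field s = insert a (Field p)"
    unfolding s_def Field_def by auto
  have pF: "x \<in> Field p" "y \<in> Field p" if "(x, y) \<in> p" for x y
    using that by (auto simp: Field_def)
  have po: "refl_on (Field p) p" "trans p" "antisym p" "total_on (Field p) p" "wf (p - Id)"
    using p by (auto simp: order_on_defs)
  have "refl_on (Field s) s"
    using po(1) unfolding Fs by (auto simp: s_def refl_on_def)
  moreover have "trans s"
    using po(2) a by (auto simp: s_def trans_def dest: pF)
  moreover have "antisym s"
    using po(3) a by (auto simp: s_def antisym_def dest: pF)
  moreover have "total_on (Field s) s"
    using po(4) unfolding Fs by (auto simp: s_def total_on_def)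
  moreover have "wf (s - Id)"
  proof -
    have "s - Id = (p - Id) \<union> (Field p \<times> {a})"
      using a by (auto simp: s_def dest: pF)
    moreover have "wf ((p - Id) \<union> (Field p \<times> {a}))"
    proof (rule wf_Un)
      show "wf (Field p \<times> {a})"
        using a by (auto intro!: wfI)
      show "Domain (p - Id) \<inter> Range (Field p \<times> {a}) = {}"
        using a by (auto dest: pF)
    qed (rule po)
    ultimately show ?thesis by simp
  qed
  moreover have "s \<subseteq> Field s \<times> Field s" by (auto simp: Field_def)
  ultimately have s: "Well_order s" by (simp add: order_on_defs)
  have "Restr s (underS s a) = p"
    using a by (auto simp: s_def underS_def dest: pF)
  then have "(r, s) \<in> ordLess"
    using ordLess_iff_ordIso_Restr[OF s r] rp Fs by auto
  then show "\<exists>s\<in>{r. (r, r) \<in> ordIso}. (r, s) \<in> (ordLess :: ('o rel \<times> 'o rel) set)"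
    using s by (auto simp: ordIso_self_Well_order)
qed

definition osuc :: "'o::infinite ordinal \<Rightarrow> 'o ordinal" where
  "osuc \<alpha> = (LEAST \<beta>. \<alpha> < \<beta>)"

lemma less_osuc: "\<alpha> < osuc \<alpha>"
  unfolding osuc_def using ex_ordinal_gt by (rule LeastI_ex)

lemma osuc_le_iff: "osuc \<alpha> \<le> \<beta> \<longleftrightarrow> \<alpha> < \<beta>"
  using less_osuc less_le_trans by (auto simp: osuc_def intro: Least_le)

lemma osuc_inject: "osuc \<alpha> = osuc \<beta> \<longleftrightarrow> \<alpha> = \<beta>"
  by (metis less_osuc osuc_le_iff linorder_neqE order.strict_trans2 order_less_irrefl)

lemma osuc_neq_zero: "osuc \<alpha> \<noteq> 0"
  by (metis less_osuc zero_ordinal_le leD)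


section \<open>Computable functions and computable ordinals\<close>

datatype recf =
    Zero
  | Succ
  | Proj nat
  | Comp recf "recf list"
  | PrimRec recf recf
  | Mu recf

lemma list_all2_rel_mono [mono]:
  "(\<And>x y. P x y \<longrightarrow> Q x y) \<Longrightarrow> list_all2 P xs ys \<longrightarrow> list_all2 Q xs ys"
  by (auto intro: list_all2_mono)

text \<open>\<open>computes p xs y\<close>: the partial recursive function described by \<open>p\<close> is defined at
  the arguments \<open>xs\<close> and has the value \<open>y\<close> there.\<close>

inductive computes :: "recf \<Rightarrow> nat list \<Rightarrow> nat \<Rightarrow> bool" where
  zero: "computes Zero xs 0"
| succ: "computes Succ (x # xs) (Suc x)"
| proj: "i < length xs \<Longrightarrow> computes (Proj i) xs (xs ! i)"
| comp: "list_all2 (\<lambda>q y. computes q xs y) qs ys \<Longrightarrow> computes p ys z \<Longrightarrow>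
    computes (Comp p qs) xs z"
| primrec_0: "computes p xs y \<Longrightarrow> computes (PrimRec p q) (0 # xs) y"
| primrec_Suc: "computes (PrimRec p q) (n # xs) y \<Longrightarrow> computes q (n # y # xs) z \<Longrightarrow>
    computes (PrimRec p q) (Suc n # xs) z"
| mu: "computes p (n # xs) 0 \<Longrightarrow> \<forall>m<n. \<exists>y. computes p (m # xs) (Suc y) \<Longrightarrow>
    computes (Mu p) xs n"

definition computable_fun :: "(nat \<Rightarrow> nat) \<Rightarrow> bool" where
  "computable_fun f \<longleftrightarrow> (\<exists>p. \<forall>n. computes p [n] (f n))"

definition computable_rel :: "nat rel \<Rightarrow> bool" where
  "computable_rel r \<longleftrightarrow> (\<exists>p. \<forall>m n. computes p [m, n] (of_bool ((m, n) \<in> r)))"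

text \<open>A computable ordinal is the order type of a computable well-order of a computable subset
  of \<open>\<nat>\<close>; since \<open>w\<close> is reflexive on its field, the field is computable if \<open>w\<close> is.\<close>

lift_definition computable_ordinal :: "'o ordinal \<Rightarrow> bool"
  is "\<lambda>r. \<exists>w :: nat rel. Well_order w \<and> computable_rel w \<and> (r, w) \<in> ordIso"
  by (metis ordIso_symmetric ordIso_transitive)

text \<open>The type \<open>'o ordinal\<close> contains a non-computable ordinal if \<open>'o\<close> is infinite: it then
  contains every countable ordinal, and only countably many ordinals are computable.\<close>

definition omega1_CK :: "'o::infinite ordinal" where
  "omega1_CK = (LEAST \<alpha>. \<not> computable_ordinal \<alpha>)"


section \<open>The ordinal of a partial combinatory algebra\<close>

text \<open>The combinators of a pca play no role in the definition of its ordinal, so only the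
  underlying partial applicative structure is recorded; \<open>app A\<close> is only relevant on the
  carrier, which it is meant to preserve.\<close>

record 'a pas =
  carrier :: "'a set"
  app :: "'a \<Rightarrow> 'a \<Rightarrow> 'a option"

datatype 'a cterm = Elem 'a | App "'a cterm" "'a cterm"

definition closed_terms :: "'a pas \<Rightarrow> 'a cterm set" where
  "closed_terms A = {t. set_cterm t \<subseteq> carrier A}"

primrec cterm_val :: "'a pas \<Rightarrow> 'a cterm \<Rightarrow> 'a option" where
  "cterm_val A (Elem a) = Some a"
| "cterm_val A (App s t) =
    Option.bind (cterm_val A s) (\<lambda>a. Option.bind (cterm_val A t) (\<lambda>b. app A a b))"

instance cterm :: (type) infinite
proof
  define g where "g n = ((\<lambda>t. App t t) ^^ n) (Elem (undefined :: 'a))" for n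
  have "size (g (Suc n)) > size (g n)" for n
    by (simp add: g_def)
  then have "inj (\<lambda>n. size (g n))"
    by (intro strict_mono_imp_inj_on strict_mono_Suc_iff[THEN iffD2]) blast
  then have "inj g" by (auto simp: inj_def)
  then show "infinite (UNIV :: 'a cterm set)"
    by (metis finite_imageD finite_subset infinite_UNIV_nat subset_UNIV)
qed

text \<open>The relations \<open>\<sim>\<^sub>\<alpha>\<close>; see the three lemmas below.\<close>

context
  notes conj_cong [fundef_cong]
begin

function sim :: "'a pas \<Rightarrow> 'o::infinite ordinal \<Rightarrow> 'a cterm \<Rightarrow> 'a cterm \<Rightarrow> bool" where
  "sim A \<alpha> s t \<longleftrightarrow>
    (if \<alpha> = 0 then cterm_val A s = cterm_val A t
     else if \<exists>\<beta>. \<alpha> = osuc \<beta> then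
       \<exists>\<beta>. \<alpha> = osuc \<beta> \<and> (\<forall>x\<in>carrier A. sim A \<beta> (App s (Elem x)) (App t (Elem x)))
     else \<exists>\<beta>. \<beta> < \<alpha> \<and> sim A \<beta> s t)"
  by pat_completeness auto
termination
  by (relation "inv_image {(\<alpha>, \<beta>). \<alpha> < \<beta>} (\<lambda>(A, \<alpha>, s, t). \<alpha>)") (auto simp: wf less_osuc)

end

declare sim.simps [simp del]

lemma sim_0: "sim A 0 s t \<longleftrightarrow> cterm_val A s = cterm_val A t"
  by (simp add: sim.simps)

lemma sim_osuc:
  "sim A (osuc \<alpha>) s t \<longleftrightarrow> (\<forall>x\<in>carrier A. sim A \<alpha> (App s (Elem x)) (App t (Elem x)))"
  by (subst sim.simps) (auto simp: osuc_neq_zero osuc_inject)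

lemma sim_limit:
  assumes "\<alpha> \<noteq> 0" "\<nexists>\<beta>. \<alpha> = osuc \<beta>"
  shows "sim A \<alpha> s t \<longleftrightarrow> (\<exists>\<beta><\<alpha>. sim A \<beta> s t)"
  using assms by (subst sim.simps) auto

text \<open>The relations \<open>\<sim>\<^sub>\<alpha>\<close> increase with \<open>\<alpha>\<close>, and as long as they do so strictly each
  step adds a new pair of closed terms. There are at most \<open>|'a cterm|\<close> such pairs, so the least
  \<open>\<alpha>\<close> below exists within the type \<open>'a cterm ordinal\<close>.\<close>

definition pca_ord :: "'a pas \<Rightarrow> 'a cterm ordinal" where
  "pca_ord A = (LEAST \<alpha>. \<forall>s\<in>closed_terms A. \<forall>t\<in>closed_terms A.
      sim A \<alpha> s t \<longleftrightarrow> sim A (osuc \<alpha>) s t)"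


section \<open>Kleene's second model\<close>

text \<open>\<open>F\<^sub>f(h) = f(\<langle>h(0), \<dots>, h(k - 1)\<rangle>) - 1\<close> for the least \<open>k\<close> making
  \<open>f(\<langle>h(0), \<dots>, h(k - 1)\<rangle>)\<close> positive, and \<open>(f \<cdot> g)(n) = F\<^sub>f(\<langle>n\<rangle>\<frown>g)\<close>, where only
  initial segments containing the entry \<open>n\<close> are queried. The product is defined iff
  it is defined at every \<open>n\<close>.\<close>

definition K2_query :: "(nat \<Rightarrow> nat) \<Rightarrow> (nat \<Rightarrow> nat) \<Rightarrow> nat \<Rightarrow> nat \<Rightarrow> nat" where
  "K2_query f g n k = f (list_encode (n # map g [0..<k]))"

definition K2_app :: "(nat \<Rightarrow> nat) \<Rightarrow> (nat \<Rightarrow> nat) \<Rightarrow> (nat \<Rightarrow> nat) option" where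
  "K2_app f g =
    (if \<forall>n. \<exists>k. K2_query f g n k > 0
     then Some (\<lambda>n. K2_query f g n (LEAST k. K2_query f g n k > 0) - 1)
     else None)"

definition K2 :: "(nat \<Rightarrow> nat) pas" where
  "K2 = \<lparr>carrier = UNIV, app = K2_app\<rparr>"

definition K2_eff :: "(nat \<Rightarrow> nat) pas" where
  "K2_eff = K2\<lparr>carrier := {f. computable_fun f}\<rparr>"

end

theory Submission
  imports Defs
begin

text \<open>
  Lower bound: let \<open>\<delta>\<close> be the computable transition function that moves from an element \<open>a\<close> of
  a computable well-order to any smaller \<open>b\<close>, and to a dead state on any other input. Elements
  \<open>e\<^sub>q\<close> with \<open>e\<^sub>q \<cdot> x = e\<^sub>p\<close> for \<open>p = \<delta> (q, x 0)\<close> then satisfy \<open>e\<^sub>q \<sim>\<^sub>\<alpha> e\<^sub>d\<close>, where \<open>d\<close> is the dead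
  state, exactly for those \<open>\<alpha>\<close> that exceed the rank of \<open>q\<close>.

  Upper bound: \<open>s\<close> and \<open>t\<close> are related by some \<open>\<sim>\<^sub>\<alpha>\<close> only if the tree of sequences
  \<open>x\<^sub>1, \<dots>, x\<^sub>n\<close> of computable functions with \<open>s x\<^sub>1 \<dots> x\<^sub>n\<close> and \<open>t x\<^sub>1 \<dots> x\<^sub>n\<close> different is
  well-founded. Membership in this tree is \<open>\<Sigma>\<^sup>1\<^sub>1\<close>: a witness lists the values of all the functions
  involved and a justification of every computation used. The finite approximations of
  witnesses form a computable well-founded tree, whose Kleene--Brouwer order is a computable
  well-order that bounds the least such \<open>\<alpha>\<close>.
\<close>

section \<open>Computability on coded types\<close>

text \<open>Arguments range over computable functions only, whereas a path through a computable tree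
  may be arbitrary. A path therefore carries, for each argument, an index and certificates that
  force the listed values to come from a single program. Divergence is universal over query lengths,
  so a path names one point of divergence and refutes every query there; a defined value carries its
  modulus, so that minimality becomes a family of local conditions. The Kleene--Brouwer order
  replaces the tree rank because initial segments of a computable well-order are visibly computable.
  One further argument extends the current node by one entry: the rank drops, which pays for one
  successor step of \<open>\<sim>\<close>. In the lower bound no recursion theorem is used: the
  self-reference among the elements is resolved by recursion on the codes of the queries.\<close>

inductive_cases computes_ZeroE: "computes Zero xs y"
inductive_cases computes_SuccE: "computes Succ xs y"
inductive_cases computes_ProjE: "computes (Proj i) xs y"
inductive_cases computes_CompE: "computes (Comp p qs) xs y"
inductive_cases computes_PrimRecE: "computes (PrimRec p q) xs y"
inductive_cases computes_MuE: "computes (Mu p) xs y"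

text \<open>In the \<open>Mu\<close> case, the smaller of two values would be a zero where the other
  run demands a positive value. Uniqueness later makes certified segments of different lengths
  agree.\<close>

lemma computes_fun: "computes p xs y \<Longrightarrow> computes p xs z \<Longrightarrow> y = z"
proof (induction arbitrary: z rule: computes.induct)
  case (comp xs qs ys p y)
  from comp.prems obtain zs where zs: "list_all2 (\<lambda>q y. computes q xs y) qs zs" "computes p zs z"
    by (auto elim: computes_CompE)
  have "ys = zs"
    using comp.IH(1) zs(1) by (auto simp: list_all2_conv_all_nth intro!: nth_equalityI)
  with comp.IH zs show ?case by auto
next
  case (mu p n xs)
  from mu.prems have z: "computes p (z # xs) 0" "\<forall>m<z. \<exists>y. computes p (m # xs) (Suc y)"
    by (auto elim: computes_MuE)
  have "\<not> n < z" using z(2) mu.IH(1) by blast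
  moreover have "\<not> z < n" using z(1) mu.IH(2) by blast
  ultimately show ?case by simp
next
  case (primrec_0 p xs y q)
  from primrec_0.prems show ?case
    by (cases rule: computes_PrimRecE) (use primrec_0.IH in auto)
next
  case (primrec_Suc p q n xs y z')
  from primrec_Suc.prems show ?case
    by (cases rule: computes_PrimRecE) (use primrec_Suc.IH in blast)+
qed (auto elim: computes_ZeroE computes_SuccE computes_ProjE)

lemma computes_Comp1: "computes q xs y \<Longrightarrow> computes p [y] z \<Longrightarrow> computes (Comp p [q]) xs z"
  by (rule computes.comp[where ys = "[y]"]) auto

lemma computes_Comp2:
  "computes q xs y \<Longrightarrow> computes q' xs y' \<Longrightarrow> computes p [y, y'] z \<Longrightarrow> computes (Comp p [q, q']) xs z"
  by (rule computes.comp[where ys = "[y, y']"]) auto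

lemma computes_Proj: "i < length xs \<Longrightarrow> y = xs ! i \<Longrightarrow> computes (Proj i) xs y"
  by (simp add: computes.proj)

primrec recf_const :: "nat \<Rightarrow> recf" where
  "recf_const 0 = Zero"
| "recf_const (Suc n) = Comp Succ [recf_const n]"

lemma computes_const: "computes (recf_const n) xs n"
  by (induction n) (auto intro: computes.zero computes_Comp1 computes.succ)

definition recf_add :: recf where
  "recf_add = PrimRec (Proj 0) (Comp Succ [Proj 1])"

lemma computes_add: "computes recf_add [m, n] (m + n)"
  unfolding recf_add_def
  by (induction m)
    (auto intro!: computes.primrec_0 computes.primrec_Suc computes_Comp1 computes.succ computes_Proj)

definition recf_pred :: recf where
  "recf_pred = PrimRec Zero (Proj 0)"

lemma computes_pred: "computes recf_pred [n] (n - 1)"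
  unfolding recf_pred_def
  by (induction n) (auto intro!: computes.primrec_0 computes.primrec_Suc computes.zero computes_Proj)

text \<open>Primitive recursion runs on the first argument, so the first argument is subtracted from
  the second.\<close>

definition recf_sub :: recf where
  "recf_sub = PrimRec (Proj 0) (Comp recf_pred [Proj 1])"

lemma computes_sub: "computes recf_sub [m, n] (n - m)"
proof (induction m)
  case (Suc m)
  have "computes recf_pred [n - m] (n - Suc m)"
    using computes_pred[of "n - m"] by simp
  then show ?case
    using Suc unfolding recf_sub_def
    by (auto intro!: computes.primrec_Suc computes_Comp1 computes_Proj)
qed (auto simp: recf_sub_def intro!: computes.primrec_0 computes_Proj)

definition recf_triangle :: recf where
  "recf_triangle = PrimRec Zero (Comp recf_add [Proj 1, Comp Succ [Proj 0]])"

lemma computes_triangle: "computes recf_triangle [n] (triangle n)"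
proof (induction n)
  case (Suc n)
  show ?case
    unfolding recf_triangle_def
    unfolding triangle_Suc
    by (rule computes.primrec_Suc[OF Suc[unfolded recf_triangle_def]])
      (rule computes_Comp2 computes_Comp1 computes_add computes.succ computes_Proj | simp (no_asm))+
qed (auto simp: recf_triangle_def intro!: computes.primrec_0 computes.zero)

definition recf_pair :: recf where
  "recf_pair = Comp recf_add [Comp recf_triangle [recf_add], Proj 0]"

lemma computes_pair: "computes recf_pair [m, n] (prod_encode (m, n))"
  unfolding recf_pair_def prod_encode_def
  by (auto intro!: computes_Comp2 computes_Comp1 computes_add computes_triangle computes_Proj)

text \<open>Since \<open>prod_encode (m, n)\<close> is \<open>triangle (m + n) + m\<close>, the
  diagonal \<open>m + n\<close> of a code \<open>c\<close> is the least \<open>s\<close> with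
  \<open>c < triangle (Suc s)\<close>; truncated subtraction turns this into a search for a
  zero.\<close>

definition recf_diag :: recf where
  "recf_diag = Mu (Comp recf_sub [Comp recf_triangle [Comp Succ [Proj 0]], Comp Succ [Proj 1]])"

lemma triangle_mono: "m \<le> n \<Longrightarrow> triangle m \<le> triangle n"
  unfolding triangle_def by (intro div_le_mono mult_le_mono) auto

lemma computes_diag: "computes recf_diag [prod_encode (m, n)] (m + n)"
proof -
  let ?p = "Comp recf_sub [Comp recf_triangle [Comp Succ [Proj 0]], Comp Succ [Proj 1]]"
  have *: "computes ?p [s, c] (Suc c - triangle (Suc s))" for s c
    by (rule computes_Comp2 computes_Comp1 computes_sub computes_triangle computes.succ computes_Proj
        | simp (no_asm))+
  have lt: "triangle (Suc s) \<le> prod_encode (m, n)" if "s < m + n" for s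
    using triangle_mono[of "Suc s" "m + n"] that by (simp add: prod_encode_def)
  show ?thesis
    unfolding recf_diag_def
  proof (rule computes.mu)
    show "computes ?p [m + n, prod_encode (m, n)] 0"
      using *[of "m + n" "prod_encode (m, n)"] by (simp add: prod_encode_def)
    show "\<forall>s<m + n. \<exists>y. computes ?p [s, prod_encode (m, n)] (Suc y)"
      using * lt by (metis Suc_diff_le)
  qed
qed

definition recf_fst :: recf where
  "recf_fst = Comp recf_sub [Comp recf_triangle [recf_diag], Proj 0]"

definition recf_snd :: recf where
  "recf_snd = Comp recf_sub [recf_fst, recf_diag]"

lemma computes_fst: "computes recf_fst [prod_encode (m, n)] m"
proof -
  have "computes recf_sub [triangle (m + n), prod_encode (m, n)] m"
    using computes_sub[of "triangle (m + n)" "prod_encode (m, n)"] by (simp add: prod_encode_def)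
  then show ?thesis
    unfolding recf_fst_def
    by (auto intro!: computes_Comp2 computes_Comp1 computes_triangle computes_diag computes_Proj)
qed

lemma computes_snd: "computes recf_snd [prod_encode (m, n)] n"
proof -
  have "computes recf_sub [m, m + n] n"
    using computes_sub[of m "m + n"] by simp
  then show ?thesis
    unfolding recf_snd_def by (rule computes_Comp2[OF computes_fst computes_diag])
qed

text \<open>A bijection, not merely an injection, makes \<open>decode\<close> a total two-sided
  inverse; passing between a value and its code then costs no computation.\<close>

class coded =
  fixes encode :: "'a \<Rightarrow> nat"
  assumes bij_encode: "bij encode"

lemma encode_inject [simp]: "encode x = encode y \<longleftrightarrow> (x :: 'a :: coded) = y"
  using bij_encode by (auto simp: bij_def dest: injD)

definition decode :: "nat \<Rightarrow> 'a :: coded" where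
  "decode = inv encode"

lemma encode_decode [simp]: "encode (decode n :: 'a :: coded) = n"
  unfolding decode_def using bij_encode by (metis bij_inv_eq_iff)

lemma decode_encode [simp]: "decode (encode x) = (x :: 'a :: coded)"
  unfolding decode_def using bij_encode by (metis bij_inv_eq_iff)

instantiation nat :: coded
begin
definition encode_nat :: "nat \<Rightarrow> nat" where [simp]: "encode_nat n = n"
instance by standard (simp add: bij_def inj_def surj_def)
end

instantiation prod :: (coded, coded) coded
begin
definition encode_prod :: "'a \<times> 'b \<Rightarrow> nat" where
  "encode_prod z = prod_encode (encode (fst z), encode (snd z))"
instance
proof
  have "surj (encode :: 'a \<times> 'b \<Rightarrow> nat)"
  proof (rule surjI)
    fix n
    show "encode (decode (fst (prod_decode n)), decode (snd (prod_decode n))) = n"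
      by (simp add: encode_prod_def)
  qed
  then show "bij (encode :: 'a \<times> 'b \<Rightarrow> nat)"
    by (auto simp: bij_def inj_def encode_prod_def prod_eq_iff)
qed
end

instantiation list :: (coded) coded
begin
definition encode_list :: "'a list \<Rightarrow> nat" where
  "encode_list xs = list_encode (map encode xs)"
instance
proof
  have "surj (encode :: 'a list \<Rightarrow> nat)"
  proof (rule surjI)
    fix n
    show "encode (map decode (list_decode n) :: 'a list) = n"
      by (simp add: encode_list_def o_def)
  qed
  moreover have "inj (encode :: 'a list \<Rightarrow> nat)"
  proof (rule injI)
    fix xs ys :: "'a list"
    assume "encode xs = encode ys"
    then have "map encode xs = map encode ys"
      unfolding encode_list_def by (simp only: list_encode_eq)
    then show "xs = ys" using map_injective[of encode xs ys] by (simp add: inj_def)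
  qed
  ultimately show "bij (encode :: 'a list \<Rightarrow> nat)" by (simp add: bij_def)
qed
end

lemma encode_nat_list: "encode (xs :: nat list) = list_encode xs"
  by (simp add: encode_list_def encode_nat_def[abs_def])

lemma encode_pair: "encode (x, y) = prod_encode (encode x, encode y)"
  by (simp add: encode_prod_def)

lemma encode_Nil: "encode [] = 0"
  by (simp add: encode_list_def)

lemma encode_Cons: "encode (x # xs) = Suc (prod_encode (encode x, encode xs))"
  by (simp add: encode_list_def)

definition computable :: "('a :: coded \<Rightarrow> 'b :: coded) \<Rightarrow> bool" where
  "computable f \<longleftrightarrow> (\<exists>p. \<forall>x. computes p [encode x] (encode (f x)))"

definition decidable :: "('a :: coded \<Rightarrow> bool) \<Rightarrow> bool" where
  "decidable P \<longleftrightarrow> computable (\<lambda>x. of_bool (P x) :: nat)"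

lemma computable_fun_iff: "computable_fun f \<longleftrightarrow> computable f"
  by (simp add: computable_fun_def computable_def)

section \<open>Closure properties of computable functions and decidable predicates\<close>

named_theorems computable_intros

lemma computable_comp:
  assumes f: "computable f" and g: "computable g"
  shows "computable (\<lambda>x. f (g x))"
  using f g unfolding computable_def by (meson computes_Comp1)

lemma computable_const [computable_intros]: "computable (\<lambda>x. c)"
  unfolding computable_def using computes_const by blast

lemma computable_id [computable_intros]: "computable (\<lambda>x. x)"
  unfolding computable_def
  by (intro exI[of _ "Proj 0"] allI computes_Proj) auto

lemma computable_Pair [computable_intros]:
  "computable f \<Longrightarrow> computable g \<Longrightarrow> computable (\<lambda>x. (f x, g x))"
  unfolding computable_def encode_prod_def fst_conv snd_conv by (meson computes_Comp2 computes_pair)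

lemma computable_fst [computable_intros]: "computable f \<Longrightarrow> computable (\<lambda>x. fst (f x))"
proof (rule computable_comp[of fst f])
  show "computable (fst :: 'b \<times> 'c \<Rightarrow> 'b)"
    unfolding computable_def encode_prod_def using computes_fst by blast
qed

lemma computable_snd [computable_intros]: "computable f \<Longrightarrow> computable (\<lambda>x. snd (f x))"
proof (rule computable_comp[of snd f])
  show "computable (snd :: 'b \<times> 'c \<Rightarrow> 'c)"
    unfolding computable_def encode_prod_def using computes_snd by blast
qed

lemma computable_Suc [computable_intros]: "computable f \<Longrightarrow> computable (\<lambda>x. Suc (f x))"
proof (rule computable_comp[of Suc f])
  show "computable Suc"
    unfolding computable_def using computes.succ by auto
qed

lemma computable_rec_nat [computable_intros]:
  fixes f :: "'a :: coded \<Rightarrow> 'b :: coded"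
  assumes f: "computable f" and g: "computable (\<lambda>z. g (fst z) (fst (snd z)) (snd (snd z)))"
    and n: "computable n"
  shows "computable (\<lambda>x. rec_nat (f x) (g x) (n x))"
proof -
  obtain pf pg pn where p: "\<And>x. computes pf [encode x] (encode (f x))"
    "\<And>x i r. computes pg [encode (x, i, r)] (encode (g x i r))"
    "\<And>x. computes pn [encode x] (n x)"
    using assms unfolding computable_def by (metis encode_nat_def fst_conv snd_conv)
  let ?q = "Comp pg [Comp recf_pair [Proj 2, Comp recf_pair [Proj 0, Proj 1]]]"
  have q: "computes ?q [i, encode r, encode x] (encode (g x i r))" for i r x
    by (rule computes_Comp1[OF _ p(2)])
      (auto simp: encode_prod_def intro!: computes_Comp2 computes_pair computes_Proj)
  have rec: "computes (PrimRec pf ?q) [k, encode x] (encode (rec_nat (f x) (g x) k))" for k x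
  proof (induction k)
    case (Suc k)
    show ?case
      using computes.primrec_Suc[OF Suc q] by simp
  qed (simp add: computes.primrec_0 p)
  show ?thesis
    unfolding computable_def
  proof (intro exI allI)
    fix x
    show "computes (Comp (PrimRec pf ?q) [pn, Proj 0]) [encode x] (encode (rec_nat (f x) (g x) (n x)))"
      by (rule computes_Comp2[OF p(3) _ rec]) (simp add: computes_Proj)
  qed
qed

lemma computable_add [computable_intros]:
  fixes f g :: "'a :: coded \<Rightarrow> nat"
  shows "computable f \<Longrightarrow> computable g \<Longrightarrow> computable (\<lambda>x. f x + g x)"
  unfolding computable_def encode_nat_def by (meson computes_Comp2 computes_add)

lemma computable_diff [computable_intros]:
  fixes f g :: "'a :: coded \<Rightarrow> nat"
  shows "computable f \<Longrightarrow> computable g \<Longrightarrow> computable (\<lambda>x. f x - g x)"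
  unfolding computable_def encode_nat_def by (meson computes_Comp2 computes_sub)

lemma computable_If [computable_intros]:
  assumes "decidable P" "computable f" "computable g"
  shows "computable (\<lambda>x. if P x then f x else g x)"
proof -
  \<comment> \<open>Case distinction is a recursion of length 0 or 1.\<close>
  have "computable (\<lambda>x. rec_nat (g x) (\<lambda>_ _. f x) (of_bool (P x)))"
    using assms unfolding decidable_def
    by (intro computable_rec_nat computable_comp[of f fst] computable_fst computable_id) auto
  moreover have "(\<lambda>x. rec_nat (g x) (\<lambda>_ _. f x) (of_bool (P x))) = (\<lambda>x. if P x then f x else g x)"
    by auto
  ultimately show ?thesis by simp
qed

lemma computable_encode [computable_intros]: "computable f \<Longrightarrow> computable (\<lambda>x. encode (f x))"
  by (simp add: computable_def)

lemma computable_decode [computable_intros]: "computable f \<Longrightarrow> computable (\<lambda>x. decode (f x))"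
  by (simp add: computable_def)

lemma decidable_zero:
  fixes f :: "'a :: coded \<Rightarrow> nat"
  assumes "computable f"
  shows "decidable (\<lambda>x. f x = 0)"
proof -
  have "(\<lambda>x. of_bool (f x = 0)) = (\<lambda>x. 1 - f x)" by auto
  then show ?thesis
    unfolding decidable_def using assms by (simp add: computable_intros)
qed

lemma decidable_const [computable_intros]: "decidable (\<lambda>x. c)"
  unfolding decidable_def by (rule computable_const)

lemma decidable_comp: "decidable P \<Longrightarrow> computable g \<Longrightarrow> decidable (\<lambda>x. P (g x))"
  unfolding decidable_def by (rule computable_comp)

lemma decidable_not [computable_intros]: "decidable P \<Longrightarrow> decidable (\<lambda>x. \<not> P x)"
  using decidable_zero[of "\<lambda>x. of_bool (P x)"] by (simp add: decidable_def)

lemma decidable_conj [computable_intros]: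
  assumes "decidable P" "decidable Q"
  shows "decidable (\<lambda>x. P x \<and> Q x)"
proof -
  have "(\<lambda>x. of_bool (P x \<and> Q x) :: nat) = (\<lambda>x. if P x then of_bool (Q x) else 0)"
    by auto
  then show ?thesis
    using computable_If[OF assms(1) assms(2)[unfolded decidable_def] computable_const]
    by (simp add: decidable_def)
qed

lemma decidable_disj [computable_intros]:
  assumes "decidable P" "decidable Q"
  shows "decidable (\<lambda>x. P x \<or> Q x)"
proof -
  have "decidable (\<lambda>x. \<not> (\<not> P x \<and> \<not> Q x))"
    using assms by (intro computable_intros)
  then show ?thesis by simp
qed

lemma decidable_imp [computable_intros]:
  "decidable P \<Longrightarrow> decidable Q \<Longrightarrow> decidable (\<lambda>x. P x \<longrightarrow> Q x)"
  unfolding imp_conv_disj by (intro computable_intros)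

lemma decidable_iff [computable_intros]:
  "decidable P \<Longrightarrow> decidable Q \<Longrightarrow> decidable (\<lambda>x. P x \<longleftrightarrow> Q x)"
  unfolding iff_conv_conj_imp by (intro computable_intros)

lemma decidable_If [computable_intros]:
  "decidable P \<Longrightarrow> decidable Q \<Longrightarrow> decidable R \<Longrightarrow> decidable (\<lambda>x. if P x then Q x else R x)"
  unfolding if_bool_eq_conj by (intro computable_intros)

lemma decidable_le [computable_intros]:
  fixes f g :: "'a :: coded \<Rightarrow> nat"
  shows "computable f \<Longrightarrow> computable g \<Longrightarrow> decidable (\<lambda>x. f x \<le> g x)"
  using decidable_zero[of "\<lambda>x. f x - g x"] by (simp add: computable_intros)

lemma decidable_less [computable_intros]:
  fixes f g :: "'a :: coded \<Rightarrow> nat"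
  shows "computable f \<Longrightarrow> computable g \<Longrightarrow> decidable (\<lambda>x. f x < g x)"
  unfolding not_le[symmetric] by (intro computable_intros)

lemma decidable_eq [computable_intros]:
  fixes f g :: "'a :: coded \<Rightarrow> 'b :: coded"
  assumes "computable f" "computable g"
  shows "decidable (\<lambda>x. f x = g x)"
proof -
  have "decidable (\<lambda>x. encode (f x) \<le> encode (g x) \<and> encode (g x) \<le> encode (f x))"
    using assms by (intro computable_intros)
  then show ?thesis by (simp add: eq_iff[symmetric])
qed

lemma decidable_all_less [computable_intros]:
  fixes n :: "'a :: coded \<Rightarrow> nat"
  assumes P: "decidable (\<lambda>z. P (fst z) (snd z))" and n: "computable n"
  shows "decidable (\<lambda>x. \<forall>i<n x. P x i)"
proof -
  have "computable (\<lambda>x. rec_nat 1 (\<lambda>i r. if P x i then r else (0 :: nat)) (n x))"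
    by (intro computable_intros n decidable_comp[OF P, of "\<lambda>z. (fst z, fst (snd z))", simplified])
  moreover have "rec_nat 1 (\<lambda>i r. if P x i then r else (0 :: nat)) k = of_bool (\<forall>i<k. P x i)" for x k
    by (induction k) (auto simp: less_Suc_eq)
  ultimately show ?thesis by (simp add: decidable_def)
qed

lemma decidable_ex_less [computable_intros]:
  fixes n :: "'a :: coded \<Rightarrow> nat"
  assumes "decidable (\<lambda>z. P (fst z) (snd z))" and "computable n"
  shows "decidable (\<lambda>x. \<exists>i<n x. P x i)"
proof -
  have "decidable (\<lambda>x. \<not> (\<forall>i<n x. \<not> P x i))"
    using assms by (intro computable_intros)
  then show ?thesis by simp
qed

lemma computable_Least:
  fixes P :: "'a :: coded \<Rightarrow> nat \<Rightarrow> bool"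
  assumes P: "decidable (\<lambda>z. P (fst z) (snd z))" and ex: "\<And>x. \<exists>n. P x n"
  shows "computable (\<lambda>x. LEAST n. P x n)"
proof -
  obtain p where p: "\<And>x n. computes p [encode (x, n)] (of_bool (\<not> P x n))"
    using decidable_not[OF P] unfolding decidable_def computable_def
    by (metis encode_nat_def fst_conv snd_conv)
  let ?p = "Comp p [Comp recf_pair [Proj 1, Proj 0]]"
  have *: "computes ?p [n, encode x] (of_bool (\<not> P x n))" for n x
    by (rule computes_Comp1[OF _ p])
      (auto simp: encode_prod_def intro!: computes_Comp2 computes_pair computes_Proj)
  have "computes (Mu ?p) [encode x] (LEAST n. P x n)" for x
  proof (rule computes.mu)
    show "computes ?p [LEAST n. P x n, encode x] 0"
      using *[of "LEAST n. P x n" x] LeastI_ex[OF ex[of x]] by simp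
    show "\<forall>m<LEAST n. P x n. \<exists>y. computes ?p [m, encode x] (Suc y)"
    proof (intro allI impI exI)
      fix m assume "m < (LEAST n. P x n)"
      then have "\<not> P x m" by (rule not_less_Least)
      then show "computes ?p [m, encode x] (Suc 0)"
        using *[of m x] by simp
    qed
  qed
  then show ?thesis unfolding computable_def by auto
qed

lemma computable_Cons [computable_intros]:
  assumes "computable f" "computable g"
  shows "computable (\<lambda>x. f x # g x)"
proof -
  have "computable (\<lambda>x. encode (f x # g x))"
    unfolding encode_Cons encode_pair[symmetric] using assms by (intro computable_intros)
  then show ?thesis by (simp add: computable_def)
qed

lemma computable_tl [computable_intros]:
  fixes f :: "'a :: coded \<Rightarrow> 'b :: coded list"
  assumes "computable f"
  shows "computable (\<lambda>x. tl (f x))"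
proof -
  \<comment> \<open>The predecessor of a nonempty list's code is the code of the pair of head and
    tail. Its second component is read as a number, namely the code of the tail.\<close>
  have "computable (\<lambda>x. if f x = [] then 0 else snd (decode (encode (f x) - 1) :: 'b \<times> nat))"
    using assms by (intro computable_intros)
  moreover have "(if xs = [] then 0 else snd (decode (encode xs - 1) :: 'b \<times> nat)) = encode (tl xs)"
    for xs :: "'b list"
  proof (cases xs)
    case (Cons a list)
    have "prod_encode (encode a, encode list) = encode (a, encode list)"
      by (simp add: encode_pair)
    then show ?thesis using Cons by (simp add: encode_Cons)
  qed (simp add: encode_Nil)
  ultimately show ?thesis by (simp add: computable_def)
qed

lemma computable_hd [computable_intros]:
  fixes f :: "'a :: coded \<Rightarrow> 'b :: coded list"
  assumes "computable f"
  shows "computable (\<lambda>x. hd (f x))"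
proof -
  have "computable (\<lambda>x. if f x = [] then hd [] else fst (decode (encode (f x) - 1) :: 'b \<times> nat))"
    using assms by (intro computable_intros)
  moreover have "(if xs = [] then hd [] else fst (decode (encode xs - 1) :: 'b \<times> nat)) = hd xs"
    for xs :: "'b list"
  proof (cases xs)
    case (Cons a list)
    have "prod_encode (encode a, encode list) = encode (a, encode list)"
      by (simp add: encode_pair)
    then show ?thesis using Cons by (simp add: encode_Cons)
  qed simp
  ultimately show ?thesis by simp
qed

text \<open>\<open>xs ! i\<close> is unspecified for \<open>i\<close> out of range, so it need not be computable there;
  the variant \<open>hd (drop i xs)\<close> takes the single junk value \<open>hd []\<close>.\<close>

lemma computable_drop [computable_intros]:
  fixes f :: "'a :: coded \<Rightarrow> 'b :: coded list"
  assumes "computable n" "computable f"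
  shows "computable (\<lambda>x. drop (n x) (f x))"
proof -
  have "computable (\<lambda>x. rec_nat (f x) (\<lambda>i r. tl r) (n x))"
    using assms by (intro computable_intros)
  moreover have "rec_nat xs (\<lambda>i r. tl r) k = drop k xs" for xs :: "'b list" and k
    by (induction k) (auto simp: drop_Suc tl_drop)
  ultimately show ?thesis by simp
qed

lemma computable_length [computable_intros]:
  fixes f :: "'a :: coded \<Rightarrow> 'b :: coded list"
  assumes "computable f"
  shows "computable (\<lambda>x. length (f x))"
proof -
  have "computable (\<lambda>xs :: 'b list. LEAST n. drop n xs = [])"
    by (rule computable_Least) (intro computable_intros, use drop_all in blast)
  moreover have "(LEAST n. drop n xs = []) = length xs" for xs :: "'b list"
    by (auto intro: Least_equality)
  ultimately show ?thesis
    using computable_comp[of length f] assms by simp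
qed

lemma computable_map_upt:
  fixes g :: "nat \<Rightarrow> 'b :: coded"
  assumes g: "computable g" and n: "computable n"
  shows "computable (\<lambda>x. map g [0..<n x])"
proof -
  \<comment> \<open>The list is built from its end: \<open>j\<close> rounds give the last
    \<open>j\<close> values.\<close>
  have "computable (\<lambda>k. rec_nat [] (\<lambda>i r. g (k - Suc i) # r) k)"
    by (intro computable_intros computable_comp[OF g])
  moreover have "rec_nat [] (\<lambda>i r. g (k - Suc i) # r) j = map g [k - j..<k]" if "j \<le> k" for j k
    using that
  proof (induction j)
    case (Suc j)
    then have "[k - Suc j..<k] = (k - Suc j) # [k - j..<k]"
      by (simp add: upt_conv_Cons Suc_diff_Suc)
    with Suc show ?case by simp
  qed simp
  ultimately have "computable (\<lambda>k. map g [0..<k])" by simp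
  then show ?thesis using n by (rule computable_comp)
qed

lemma computable_rel_iff: "computable_rel r \<longleftrightarrow> decidable (\<lambda>z. z \<in> r)"
proof
  assume "computable_rel r"
  then obtain p where p: "\<And>m n. computes p [m, n] (of_bool ((m, n) \<in> r))"
    unfolding computable_rel_def by blast
  have "computes (Comp p [recf_fst, recf_snd]) [encode z] (of_bool (z \<in> r))" for z :: "nat \<times> nat"
    using computes_Comp2[OF computes_fst computes_snd p[of "fst z" "snd z"]]
    by (simp add: encode_prod_def)
  then show "decidable (\<lambda>z. z \<in> r)"
    unfolding decidable_def computable_def encode_nat_def by blast
next
  assume "decidable (\<lambda>z. z \<in> r)"
  then obtain p where p: "\<And>z. computes p [encode z] (of_bool (z \<in> r))"
    unfolding decidable_def computable_def encode_nat_def by blast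
  have "computes (Comp p [recf_pair]) [m, n] (of_bool ((m, n) \<in> r))" for m n
  proof -
    have "computes p [prod_encode (m, n)] (of_bool ((m, n) \<in> r))"
      using p[of "(m, n)"] by (simp add: encode_pair)
    then show ?thesis by (rule computes_Comp1[OF computes_pair])
  qed
  then show "computable_rel r" unfolding computable_rel_def by blast
qed

text \<open>Each modulus is found by unbounded search, which halts because the product is
  defined.\<close>

lemma K2_app_computable:
  assumes f: "computable f" and g: "computable g" and h: "K2_app f g = Some h"
  shows "computable h"
proof -
  have ex: "\<exists>k. K2_query f g n k > 0" for n
    using h by (auto simp: K2_app_def split: if_splits)
  have q: "computable (\<lambda>z. K2_query f g (fst z) (snd z))"
    unfolding K2_query_def encode_nat_list[symmetric]
    by (intro computable_comp[OF f] computable_intros computable_map_upt g)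
  have "computable (\<lambda>n. LEAST k. K2_query f g n k > 0)"
    by (intro computable_Least computable_intros q ex)
  then have "computable (\<lambda>n. K2_query f g n (LEAST k. K2_query f g n k > 0) - 1)"
    by (intro computable_intros computable_comp[OF q, of "\<lambda>n. (n, LEAST k. K2_query f g n k > 0)", simplified])
  then show ?thesis using h by (auto simp: K2_app_def split: if_splits)
qed

lemma cterm_val_K2_eff_computable:
  "t \<in> closed_terms K2_eff \<Longrightarrow> cterm_val K2_eff t = Some f \<Longrightarrow> computable f"
proof (induction t arbitrary: f)
  case (Elem x)
  then show ?case by (simp add: closed_terms_def K2_eff_def computable_fun_iff)
next
  case (App s t)
  then show ?case
    by (auto simp: closed_terms_def K2_eff_def K2_def bind_eq_Some_conv intro: K2_app_computable)
qed

section \<open>Order types of well-orders of natural numbers\<close>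

text \<open>Computable orders live on \<open>nat\<close>, representatives of ordinals on
  \<open>'o\<close>; any injection transports the former, and its choice is immaterial up to
  isomorphism.\<close>

definition nat_into :: "nat \<Rightarrow> 'o :: infinite" where
  "nat_into = (SOME f. inj f)"

lemma inj_nat_into: "inj (nat_into :: nat \<Rightarrow> 'o :: infinite)"
proof -
  have "\<exists>f :: nat \<Rightarrow> 'o. inj f"
    using infinite_countable_subset[of "UNIV :: 'o set"] infinite_UNIV by blast
  then show ?thesis unfolding nat_into_def by (rule someI_ex)
qed

definition otype :: "nat rel \<Rightarrow> 'o :: infinite ordinal" where
  "otype w = abs_ordinal (dir_image w nat_into)"

lemma ordIso_dir_image:
  "Well_order w \<Longrightarrow> (w, dir_image w (nat_into :: nat \<Rightarrow> 'o :: infinite)) \<in> ordIso"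
  using inj_nat_into by (metis dir_image_ordIso inj_on_subset subset_UNIV)

lemma dir_image_refl:
  "Well_order w \<Longrightarrow> (dir_image w (nat_into :: nat \<Rightarrow> 'o :: infinite), dir_image w nat_into) \<in> ordIso"
  using ordIso_dir_image by (meson ordIso_symmetric ordIso_transitive)

lemma otype_less_iff:
  assumes "Well_order v" "Well_order w"
  shows "(otype v :: 'o :: infinite ordinal) < otype w \<longleftrightarrow> (v, w) \<in> ordLess"
proof -
  have "(otype v :: 'o ordinal) < otype w \<longleftrightarrow>
      (dir_image v (nat_into :: nat \<Rightarrow> 'o), dir_image w (nat_into :: nat \<Rightarrow> 'o)) \<in> ordLess"
    unfolding otype_def using assms by (simp add: less_ordinal.abs_eq eq_onp_def dir_image_refl)
  then show ?thesis
    using ordIso_dir_image[OF assms(1), where 'o = 'o] ordIso_dir_image[OF assms(2), where 'o = 'o]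
    by (meson ordIso_ordLess_trans ordIso_symmetric ordLess_ordIso_trans)
qed

lemma computable_otype:
  assumes "Well_order w" "computable_rel w"
  shows "computable_ordinal (otype w :: 'o :: infinite ordinal)"
  unfolding otype_def computable_ordinal.abs_eq[OF dir_image_refl[OF assms(1)]]
  using assms ordIso_dir_image[OF assms(1)] ordIso_symmetric by blast

lemma computable_ordinalE:
  assumes "computable_ordinal (\<alpha> :: 'o :: infinite ordinal)"
  obtains w where "Well_order w" "computable_rel w" "\<alpha> = otype w"
proof -
  obtain r where r: "(r, r) \<in> ordIso" "\<alpha> = abs_ordinal r"
    using Quotient_abs_rep[OF Quotient_ordinal] Quotient_rep_reflp[OF Quotient_ordinal] by metis
  then obtain w where w: "Well_order w" "computable_rel w" "(r, w) \<in> ordIso"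
    using assms by (auto simp: computable_ordinal.abs_eq eq_onp_def)
  then have "(r, dir_image w (nat_into :: nat \<Rightarrow> 'o)) \<in> ordIso"
    using ordIso_dir_image ordIso_transitive by blast
  then have "\<alpha> = otype w"
    using r dir_image_refl[OF w(1)] Quotient_rel[OF Quotient_ordinal]
    unfolding otype_def by blast
  with w that show ?thesis by blast
qed

definition orank :: "nat rel \<Rightarrow> nat \<Rightarrow> 'o :: infinite ordinal" where
  "orank w a = otype (Restr w (underS w a))"

lemma orank_less_otype:
  assumes "Well_order w" "a \<in> Field w"
  shows "(orank w a :: 'o :: infinite ordinal) < otype w"
proof -
  have "(Restr w (underS w a), w) \<in> ordLess"
    using assms by (intro underS_Restr_ordLess) auto
  then show ?thesis
    unfolding orank_def using assms(1) by (simp only: otype_less_iff Well_order_Restr)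
qed

lemma orank_less:
  assumes "Well_order w" "(a, b) \<in> w" "a \<noteq> b"
  shows "(orank w a :: 'o :: infinite ordinal) < orank w b"
proof -
  have "underS w a \<subset> underS w b"
    using assms by (auto simp: underS_def order_on_defs trans_def antisym_def)
  then have "(Restr w (underS w a), Restr w (underS w b)) \<in> ordLess"
    using ofilter_subset_ordLess[OF assms(1)] assms(1)
    by (simp add: wo_rel.underS_ofilter wo_rel_def)
  then show ?thesis
    unfolding orank_def using assms(1) by (simp add: otype_less_iff Well_order_Restr)
qed

text \<open>Every smaller well-order is isomorphic to a segment below some element. Together with
  \<open>orank_less_otype\<close>, the ranks in \<open>w\<close> are exactly the ordinals below
  \<open>otype w\<close>.\<close>

lemma less_otypeE:
  assumes w: "Well_order w" and less: "(\<delta> :: 'o :: infinite ordinal) < otype w"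
  obtains a where "a \<in> Field w" "\<delta> = orank w a"
proof -
  obtain r where r: "(r, r) \<in> ordIso" "\<delta> = abs_ordinal r"
    using Quotient_abs_rep[OF Quotient_ordinal] Quotient_rep_reflp[OF Quotient_ordinal] by metis
  have "(r, dir_image w (nat_into :: nat \<Rightarrow> 'o)) \<in> ordLess"
    using less unfolding r(2) otype_def less_ordinal.abs_eq[OF r(1) dir_image_refl[OF w]] .
  then have "(r, w) \<in> ordLess"
    using ordIso_dir_image[OF w] by (meson ordIso_symmetric ordLess_ordIso_trans)
  then obtain a where a: "a \<in> Field w" "(r, Restr w (underS w a)) \<in> ordIso"
    using ordLess_iff_ordIso_Restr[OF w] r(1) by (auto simp: ordIso_self_Well_order)
  then have "(r, dir_image (Restr w (underS w a)) (nat_into :: nat \<Rightarrow> 'o)) \<in> ordIso"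
    using ordIso_dir_image[OF Well_order_Restr[OF w]] ordIso_transitive by blast
  then have "\<delta> = orank w a"
    using r dir_image_refl[OF Well_order_Restr[OF w]] Quotient_rel[OF Quotient_ordinal]
    unfolding orank_def otype_def by blast
  with a that show ?thesis by blast
qed

lemma less_orankE:
  assumes w: "Well_order w" and b: "b \<in> Field w" and less: "(\<delta> :: 'o :: infinite ordinal) < orank w b"
  obtains a where "(a, b) \<in> w" "a \<noteq> b" "\<delta> = orank w a"
proof -
  obtain a where a: "a \<in> Field w" "\<delta> = orank w a"
    using less_trans[OF less orank_less_otype[OF w b]] by (rule less_otypeE[OF w])
  have "(b, a) \<notin> w \<and> a \<noteq> b"
    using orank_less[OF w, of b a, where 'o = 'o] less a(2) by (auto dest: less_asym)
  then have "(a, b) \<in> w" "a \<noteq> b"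
    using w a(1) b by (auto simp: order_on_defs total_on_def)
  with a that show ?thesis by blast
qed

lemma computable_rel_underS:
  assumes "computable_rel w"
  shows "computable_rel (Restr w (underS w a))"
proof -
  have w: "decidable (\<lambda>z. z \<in> w)" using assms by (simp add: computable_rel_iff)
  have "decidable (\<lambda>z. z \<in> w \<and> ((fst z, a) \<in> w \<and> fst z \<noteq> a) \<and> ((snd z, a) \<in> w \<and> snd z \<noteq> a))"
    by (intro computable_intros decidable_comp[OF w])
  moreover have "(\<lambda>z. z \<in> w \<and> ((fst z, a) \<in> w \<and> fst z \<noteq> a) \<and> ((snd z, a) \<in> w \<and> snd z \<noteq> a)) =
      (\<lambda>z. z \<in> Restr w (underS w a))"
    by (auto simp: underS_def)
  ultimately show ?thesis by (simp add: computable_rel_iff)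
qed

lemma computable_orank:
  "Well_order w \<Longrightarrow> computable_rel w \<Longrightarrow> computable_ordinal (orank w a :: 'o :: infinite ordinal)"
  unfolding orank_def by (intro computable_otype Well_order_Restr computable_rel_underS)

section \<open>Computable ordinals as an initial segment of the ordinals\<close>

lemma not_inj_cterm_nat: "\<not> inj (f :: (nat \<Rightarrow> nat) cterm \<Rightarrow> nat)"
proof
  assume f: "inj f"
  define h where "h x = f (Elem x)" for x
  have h: "inj h" using f by (auto simp: inj_def h_def)
  define g where "g n = Suc (inv h n n)" for n
  have "g (h g) = Suc (g (h g))"
    by (subst (1) g_def) (simp add: h)
  then show False by simp
qed

text \<open>The \<open>LEAST\<close> in \<open>omega1_CK\<close> has meaning only if such an ordinal
  exists. The type of closed terms is uncountable by diagonalisation, so a well-order of all of it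
  cannot be isomorphic to one on numbers.\<close>

lemma ex_noncomputable_ordinal: "\<exists>\<alpha> :: (nat \<Rightarrow> nat) cterm ordinal. \<not> computable_ordinal \<alpha>"
proof -
  obtain r :: "(nat \<Rightarrow> nat) cterm rel" where *: "Well_order r \<and> Field r = UNIV"
    by (rule exE[OF well_ordering])
  note r = conjunct1[OF *] conjunct2[OF *]
  have "\<not> computable_ordinal (abs_ordinal r)"
  proof
    assume "computable_ordinal (abs_ordinal r)"
    then obtain w :: "nat rel" where "(r, w) \<in> ordIso"
      unfolding computable_ordinal.abs_eq[OF ordIso_reflexive[OF r(1)]] by blast
    then obtain f where "iso r w f" unfolding ordIso_def by blast
    then have "inj f" using r(2) by (simp add: iso_def bij_betw_def)
    then show False using not_inj_cterm_nat by blast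
  qed
  then show ?thesis ..
qed

text \<open>Computable ordinals are closed downwards: a smaller ordinal is the type of a segment
  below a fixed element, and that segment inherits computability.\<close>

lemma less_omega1_CK_iff:
  "(\<alpha> :: (nat \<Rightarrow> nat) cterm ordinal) < omega1_CK \<longleftrightarrow> computable_ordinal \<alpha>"
proof
  show "\<alpha> < omega1_CK \<Longrightarrow> computable_ordinal \<alpha>"
    unfolding omega1_CK_def using not_less_Least by blast
next
  assume \<alpha>: "computable_ordinal \<alpha>"
  have nc: "\<not> computable_ordinal (omega1_CK :: (nat \<Rightarrow> nat) cterm ordinal)"
    unfolding omega1_CK_def by (rule LeastI_ex[OF ex_noncomputable_ordinal])
  obtain w where w: "Well_order w" "computable_rel w" "\<alpha> = otype w"
    using \<alpha> by (rule computable_ordinalE)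
  show "\<alpha> < omega1_CK"
  proof (rule ccontr)
    assume "\<not> \<alpha> < omega1_CK"
    then consider "omega1_CK = \<alpha>" | "omega1_CK < \<alpha>" by fastforce
    then show False
    proof cases
      case 1
      then show False using nc \<alpha> by simp
    next
      case 2
      then obtain a where "(omega1_CK :: (nat \<Rightarrow> nat) cterm ordinal) = orank w a"
        using less_otypeE[OF w(1)] w(3) by metis
      then show False using nc computable_orank[OF w(1,2)] by metis
    qed
  qed
qed

section \<open>The relations \<open>\<sim>\<^sub>\<alpha>\<close>\<close>

lemma ordinal_induct [case_names zero osuc limit]:
  fixes \<alpha> :: "'o :: infinite ordinal"
  assumes zero: "P 0" and osuc: "\<And>\<beta>. (\<And>\<gamma>. \<gamma> \<le> \<beta> \<Longrightarrow> P \<gamma>) \<Longrightarrow> P (osuc \<beta>)"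
    and limit: "\<And>\<alpha>. \<alpha> \<noteq> 0 \<Longrightarrow> \<nexists>\<beta>. \<alpha> = osuc \<beta> \<Longrightarrow> (\<And>\<beta>. \<beta> < \<alpha> \<Longrightarrow> P \<beta>) \<Longrightarrow> P \<alpha>"
  shows "P \<alpha>"
proof (induction \<alpha> rule: less_induct)
  case (less \<alpha>)
  show ?case
  proof (cases "\<exists>\<beta>. \<alpha> = osuc \<beta>")
    case True
    then obtain \<beta> where \<beta>: "\<alpha> = osuc \<beta>" by blast
    then show ?thesis
      using osuc[of \<beta>] less le_less_trans[OF _ less_osuc[of \<beta>]] by simp
  next
    case False
    then show ?thesis using zero limit[of \<alpha>] less by (cases "\<alpha> = 0") auto
  qed
qed

lemma osuc_less_limit:
  assumes "\<nexists>\<beta>. \<alpha> = osuc \<beta>" "\<beta> < \<alpha>"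
  shows "osuc \<beta> < \<alpha>"
  using assms by (metis osuc_le_iff order_le_less)

lemma less_osuc_iff: "\<alpha> < osuc \<beta> \<longleftrightarrow> \<alpha> \<le> \<beta>"
  using osuc_le_iff[of \<beta> \<alpha>] by (metis not_le)

text \<open>An application may thus be replaced by the element it evaluates to; the lower bound uses
  this to follow changes of state.\<close>

lemma sim_cong:
  assumes "cterm_val A s = cterm_val A s'" "cterm_val A t = cterm_val A t'"
  shows "sim A \<alpha> s t \<longleftrightarrow> sim A \<alpha> s' t'"
  using assms
proof (induction \<alpha> arbitrary: s s' t t' rule: ordinal_induct)
  case zero
  then show ?case by (simp add: sim_0)
next
  case (osuc \<beta>)
  have "sim A \<beta> (App s (Elem x)) (App t (Elem x)) \<longleftrightarrow> sim A \<beta> (App s' (Elem x)) (App t' (Elem x))" for x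
    by (rule osuc.IH) (simp_all add: osuc.prems)
  then show ?case by (simp add: sim_osuc)
next
  case (limit \<alpha>)
  then show ?case unfolding sim_limit[OF limit.hyps] by blast
qed

lemma sim_eq: "cterm_val A s = cterm_val A t \<Longrightarrow> sim A \<alpha> s t"
proof (induction \<alpha> arbitrary: s t rule: ordinal_induct)
  case (limit \<alpha>)
  have "0 < \<alpha>" using limit.hyps(1) zero_ordinal_le[of \<alpha>] by simp
  with limit show ?case unfolding sim_limit[OF limit.hyps] by blast
qed (simp_all add: sim_0 sim_osuc)

lemma sim_App: "sim A \<alpha> s t \<Longrightarrow> x \<in> carrier A \<Longrightarrow> sim A \<alpha> (App s (Elem x)) (App t (Elem x))"
proof (induction \<alpha> arbitrary: s t x rule: ordinal_induct)
  case (limit \<alpha>)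
  then show ?case unfolding sim_limit[OF limit.hyps] by blast
qed (auto simp: sim_0 sim_osuc)

text \<open>The successor step rests on \<open>sim_App\<close>: a common argument on both sides does
  not destroy the relation.\<close>

lemma sim_mono: "sim A \<beta> s t \<Longrightarrow> \<beta> \<le> \<gamma> \<Longrightarrow> sim A \<gamma> s t"
proof (induction \<gamma> arbitrary: s t rule: ordinal_induct)
  case zero
  then show ?case using zero_ordinal_le[of \<beta>] by (metis antisym)
next
  case (osuc \<delta>)
  show ?case
  proof (cases "\<beta> = osuc \<delta>")
    case False
    then have "\<beta> \<le> \<delta>" using osuc.prems less_osuc_iff by (metis order_le_less)
    then have "sim A \<delta> s t" using osuc by blast
    then show ?thesis by (simp add: sim_osuc sim_App)
  qed (use osuc.prems in simp)
next
  case (limit \<gamma>)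
  then show ?case unfolding sim_limit[OF limit.hyps] by (metis order_le_less sim_limit)
qed

primrec app_seq :: "'a cterm \<Rightarrow> (nat \<Rightarrow> 'a) \<Rightarrow> nat \<Rightarrow> 'a cterm" where
  "app_seq t X 0 = t"
| "app_seq t X (Suc n) = App (app_seq t X n) (Elem (X n))"

lemma ex_sim_vals_eq:
  assumes "sim A \<alpha> s t" "\<And>i. X i \<in> carrier A"
  shows "\<exists>n. cterm_val A (app_seq s X n) = cterm_val A (app_seq t X n)"
proof -
  \<comment> \<open>Each successor step of the induction consumes one argument, so the claim is
    proved from every starting point \<open>m\<close>.\<close>
  have "\<exists>n. cterm_val A (app_seq s X n) = cterm_val A (app_seq t X n)"
    if "sim A \<alpha> (app_seq s X m) (app_seq t X m)" for m
    using that
  proof (induction \<alpha> arbitrary: m rule: ordinal_induct)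
    case (osuc \<beta>)
    then have "sim A \<beta> (app_seq s X (Suc m)) (app_seq t X (Suc m))"
      using assms(2) by (simp add: sim_osuc)
    then show ?case by (rule osuc.IH[OF order_refl])
  next
    case (limit \<alpha>)
    then show ?case unfolding sim_limit[OF limit.hyps] by blast
  qed (auto simp: sim_0)
  from this[of 0] assms(1) show ?thesis by simp
qed

section \<open>The lower bound\<close>

text \<open>The value at \<open>0\<close>, the code of the empty list, is never queried; it serves to make
  \<open>trace \<delta> q\<close> injective in \<open>q\<close>.\<close>

function trace :: "(nat \<times> nat \<Rightarrow> nat) \<Rightarrow> nat \<Rightarrow> nat \<Rightarrow> nat" where
  "trace \<delta> q c = (case list_decode c of [] \<Rightarrow> q | [n] \<Rightarrow> 0 | n # b # h \<Rightarrow> Suc (trace \<delta> (\<delta> (q, b)) n))"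
  by pat_completeness auto
termination
proof (relation "measure (\<lambda>(\<delta>, q, c). c)", simp)
  fix \<delta> :: "nat \<times> nat \<Rightarrow> nat" and q c n b h xs
  assume "list_decode c = n # xs"
  then have "c = list_encode (n # xs)" by (metis list_decode_inverse)
  then have "n < c" by (simp add: le_imp_less_Suc le_prod_encode_1)
  then show "((\<delta>, \<delta> (q, b), n), \<delta>, q, c) \<in> measure (\<lambda>(\<delta>, q, c). c)" by simp
qed

declare trace.simps [simp del]

lemma trace_simps [simp]:
  "trace \<delta> q 0 = q"
  "trace \<delta> q (list_encode [n]) = 0"
  "trace \<delta> q (list_encode (n # b # h)) = Suc (trace \<delta> (\<delta> (q, b)) n)"
  by (subst trace.simps, simp del: list_encode.simps)+

text \<open>The shortest query shows only \<open>n\<close> and is answered 0, that is, undecided;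
  the next one also shows \<open>x 0\<close> and is decided. So exactly one value of
  \<open>x\<close> is read.\<close>

lemma K2_app_trace: "K2_app (trace \<delta> q) x = Some (trace \<delta> (\<delta> (q, x 0)))"
proof -
  have 0: "K2_query (trace \<delta> q) x n 0 = 0" for n
    by (simp add: K2_query_def del: list_encode.simps)
  have Suc: "K2_query (trace \<delta> q) x n (Suc k) = Suc (trace \<delta> (\<delta> (q, x 0)) n)" for n k
    by (simp add: K2_query_def upt_conv_Cons del: list_encode.simps upt_Suc)
  have "(LEAST k. K2_query (trace \<delta> q) x n k > 0) = 1" for n
    by (rule Least_equality) (use 0 Suc in \<open>auto simp: not_less_eq_eq[symmetric] Suc_le_eq intro: gr0I\<close>)
  moreover have "\<exists>k. K2_query (trace \<delta> q) x n k > 0" for n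
    using Suc[of n 0] by (metis zero_less_Suc)
  ultimately show ?thesis
    using Suc[of _ 0] by (simp add: K2_app_def)
qed

text \<open>The state changes along the recursion, so it is run as an iteration on triples: state,
  remaining list, number of successors collected.\<close>

lemma computable_trace:
  assumes \<delta>: "computable \<delta>"
  shows "computable (trace \<delta> q)"
proof -
  define stp :: "nat \<times> nat list \<times> nat \<Rightarrow> nat \<times> nat list \<times> nat" where
    "stp z = (if tl (fst (snd z)) = [] then z
      else (\<delta> (fst z, hd (tl (fst (snd z)))), decode (hd (fst (snd z))), Suc (snd (snd z))))" for z
  \<comment> \<open>The invariant: successors already collected plus the value still to be
    computed.\<close>
  define val :: "nat \<times> nat list \<times> nat \<Rightarrow> nat" where
    "val z = snd (snd z) + trace \<delta> (fst z) (encode (fst (snd z)))" for z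
  have stp: "computable stp"
    unfolding stp_def[abs_def] by (intro computable_intros computable_comp[OF \<delta>])
  have c: "computable (\<lambda>c. rec_nat (q, decode c, 0) (\<lambda>_ z. stp z) c)" (is "computable ?run")
    by (intro computable_intros computable_comp[OF stp])
  have "computable (\<lambda>c. if fst (snd (?run c)) = [] then snd (snd (?run c)) + fst (?run c) else snd (snd (?run c)))"
    by (intro computable_intros c)
  moreover have "(if fst (snd (?run c)) = [] then snd (snd (?run c)) + fst (?run c) else snd (snd (?run c))) =
      trace \<delta> q c" for c
  proof -
    let ?z = "\<lambda>i. rec_nat (q, decode c, 0) (\<lambda>_ z. stp z) i"
    have val_step: "val (stp z) = val z" for z
    proof (cases z)
      case (fields p l a)
      show ?thesis
      proof (cases "tl l = []")
        case False
        then obtain n b h where "l = n # b # h" by (metis list.exhaust list.sel(3) list.sel(2))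
        then show ?thesis
          by (simp add: fields stp_def val_def encode_nat_list flip: encode_nat_list del: list_encode.simps)
            (simp add: encode_nat_list del: list_encode.simps)
      qed (simp add: fields stp_def)
    qed
    have val: "val (?z i) = trace \<delta> q c" for i
      by (induction i) (simp_all add: val_step, simp add: val_def)
    \<comment> \<open>An active round passes from a list to the one coded by its head, which is a
      smaller number. Hence \<open>c\<close> rounds lead to a list of at most one entry.\<close>
    have dec: "tl (fst (snd (?z i))) = [] \<or> encode (fst (snd (?z i))) + i \<le> c" for i
    proof (induction i)
      case (Suc i)
      show ?case
      proof (cases "tl (fst (snd (?z i))) = []")
        case True
        then show ?thesis by (simp add: stp_def)
      next
        case False
        then obtain n xs where nxs: "fst (snd (?z i)) = n # xs" by (metis list.exhaust list.sel(2))
        have "n < encode (n # xs)"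
          by (simp add: encode_Cons le_imp_less_Suc le_prod_encode_1)
        then show ?thesis using Suc False nxs by (auto simp: stp_def)
      qed
    qed simp
    have "tl (fst (snd (?run c))) = []"
    proof (rule ccontr)
      assume "tl (fst (snd (?run c))) \<noteq> []"
      moreover from this have "encode (fst (snd (?run c))) = encode ([] :: nat list)"
        using dec[of c] by (simp add: encode_Nil)
      ultimately show False by (simp del: encode_Nil)
    qed
    then consider "fst (snd (?run c)) = []" | n where "fst (snd (?run c)) = [n]"
      by (metis list.exhaust list.sel(3))
    then show ?thesis
    proof cases
      case 1
      then show ?thesis using val[of c] by (simp add: val_def encode_Nil)
    next
      case 2
      then show ?thesis using val[of c] by (simp add: val_def encode_nat_list del: list_encode.simps)
    qed
  qed
  ultimately show ?thesis by simp
qed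

lemma K2_eff_simps: "carrier K2_eff = {f. computable f}" "app K2_eff = K2_app"
  by (auto simp: K2_eff_def K2_def computable_fun_iff)

lemma computable_ordinal_strict:
  fixes \<alpha> :: "'o :: infinite ordinal"
  assumes "computable_ordinal \<alpha>"
  obtains s t where "s \<in> closed_terms K2_eff" "t \<in> closed_terms K2_eff"
    "sim K2_eff (osuc \<alpha>) s t" "\<not> sim K2_eff \<alpha> s t"
proof -
  obtain w where w: "Well_order w" "computable_rel w" "\<alpha> = otype w"
    using assms by (rule computable_ordinalE)
  \<comment> \<open>State 0 is dead, state 1 lies above the whole order, and state
    \<open>b + 2\<close> stands for the element \<open>b\<close>. By reflexivity
    \<open>(b, b) \<in> w\<close> says that \<open>b\<close> is in the field.\<close>
  define below where "below q b \<longleftrightarrow> q = 1 \<and> (b, b) \<in> w \<or> 2 \<le> q \<and> (b, q - 2) \<in> w \<and> b \<noteq> q - 2" for q b :: nat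
  define \<delta> where "\<delta> z = (if below (fst z) (snd z) then snd z + 2 else 0)" for z
  define rk :: "nat \<Rightarrow> 'o ordinal" where "rk q = (if q = 1 then otype w else orank w (q - 2))" for q
  define e where "e q = trace \<delta> q" for q
  have dw: "decidable (\<lambda>z. z \<in> w)" using w(2) by (simp add: computable_rel_iff)
  have "computable \<delta>"
    unfolding \<delta>_def[abs_def] below_def
    by (intro computable_intros decidable_comp[OF dw])
  then have e: "computable (e q)" for q unfolding e_def by (rule computable_trace)
  have e_inj: "e p = e q \<longleftrightarrow> p = q" for p q
    unfolding e_def by (metis trace_simps(1))
  have step: "cterm_val K2_eff (App (Elem (e q)) (Elem x)) = cterm_val K2_eff (Elem (e (\<delta> (q, x 0))))" for q x
    by (simp add: K2_eff_simps e_def K2_app_trace)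
  have \<delta>0: "\<delta> (0, b) = 0" for b by (simp add: \<delta>_def below_def)
  \<comment> \<open>If \<open>\<gamma> < rk q\<close>, then \<open>\<gamma>\<close> is itself the
    rank of an admissible move, so it is no strict bound on all moves.\<close>
  have rk: "(\<forall>b. below q b \<longrightarrow> orank w b < \<gamma>) \<longleftrightarrow> rk q \<le> \<gamma>"
    if "q = 1 \<or> 2 \<le> q \<and> q - 2 \<in> Field w" for q and \<gamma> :: "'o ordinal"
  proof -
    have "\<exists>b. below q b \<and> \<gamma> = orank w b" if "\<gamma> < rk q"
    proof (cases "q = 1")
      case True
      then obtain b where b: "b \<in> Field w" "\<gamma> = orank w b"
        using less_otypeE[OF w(1)] \<open>\<gamma> < rk q\<close> by (auto simp: rk_def)
      have "(b, b) \<in> w" using w(1) b by (auto simp: order_on_defs refl_on_def)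
      with b True show ?thesis by (auto simp: below_def)
    next
      case False
      with \<open>q = 1 \<or> _\<close> have q: "2 \<le> q" "q - 2 \<in> Field w" by auto
      obtain b where "(b, q - 2) \<in> w" "b \<noteq> q - 2" "\<gamma> = orank w b"
        using less_orankE[OF w(1) q(2)] \<open>\<gamma> < rk q\<close> False by (auto simp: rk_def)
      with q show ?thesis by (auto simp: below_def)
    qed
    moreover have "orank w b < rk q" if "below q b" for b
      using that orank_less_otype[OF w(1)] orank_less[OF w(1)]
      by (auto simp: below_def rk_def Field_def)
    ultimately show ?thesis
      using less_le_trans by (force simp flip: not_less)
  qed
  have main: "sim K2_eff \<beta> (Elem (e q)) (Elem (e 0)) \<longleftrightarrow> rk q < \<beta>"
    if "q = 1 \<or> 2 \<le> q \<and> q - 2 \<in> Field w" for q and \<beta> :: "'o ordinal"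
    using that
  proof (induction \<beta> arbitrary: q rule: ordinal_induct)
    case zero
    then show ?case using zero_ordinal_le[of "rk q"] by (auto simp: sim_0 e_inj not_less[symmetric])
  next
    case (osuc \<gamma>)
    have "sim K2_eff \<gamma> (App (Elem (e q)) (Elem x)) (App (Elem (e 0)) (Elem x)) \<longleftrightarrow>
        sim K2_eff \<gamma> (Elem (e (\<delta> (q, x 0)))) (Elem (e 0))" for x
      using sim_cong[OF step[of q x] step[of 0 x], of \<gamma>] by (simp only: \<delta>0)
    then have "sim K2_eff (osuc \<gamma>) (Elem (e q)) (Elem (e 0)) \<longleftrightarrow>
        (\<forall>x :: nat \<Rightarrow> nat. computable x \<longrightarrow> sim K2_eff \<gamma> (Elem (e (\<delta> (q, x 0)))) (Elem (e 0)))"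
      unfolding sim_osuc K2_eff_simps by simp
    \<comment> \<open>Only \<open>x 0\<close> matters, and constant functions are computable, so
      every move is available.\<close>
    also have "\<dots> \<longleftrightarrow> (\<forall>b. sim K2_eff \<gamma> (Elem (e (\<delta> (q, b)))) (Elem (e 0)))"
    proof
      assume *: "\<forall>x :: nat \<Rightarrow> nat. computable x \<longrightarrow> sim K2_eff \<gamma> (Elem (e (\<delta> (q, x 0)))) (Elem (e 0))"
      show "\<forall>b. sim K2_eff \<gamma> (Elem (e (\<delta> (q, b)))) (Elem (e 0))"
      proof
        fix b
        show "sim K2_eff \<gamma> (Elem (e (\<delta> (q, b)))) (Elem (e 0))"
          using *[rule_format, of "\<lambda>_. b", OF computable_const] .
      qed
    qed blast
    also have "\<dots> \<longleftrightarrow> (\<forall>b. below q b \<longrightarrow> sim K2_eff \<gamma> (Elem (e (b + 2))) (Elem (e 0)))"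
      by (auto simp: \<delta>_def sim_eq)
    also have "\<dots> \<longleftrightarrow> (\<forall>b. below q b \<longrightarrow> orank w b < \<gamma>)"
    proof (intro iff_allI imp_cong refl)
      fix b assume "below q b"
      then have "b \<in> Field w" by (auto simp: below_def Field_def)
      then show "sim K2_eff \<gamma> (Elem (e (b + 2))) (Elem (e 0)) \<longleftrightarrow> orank w b < \<gamma>"
        using osuc.IH[of \<gamma> "b + 2"] by (simp add: rk_def)
    qed
    also have "\<dots> \<longleftrightarrow> rk q < osuc \<gamma>"
      using rk[OF osuc.prems] by (simp add: less_osuc_iff)
    finally show ?case .
  next
    case (limit \<beta>)
    have "sim K2_eff \<beta> (Elem (e q)) (Elem (e 0)) \<longleftrightarrow> (\<exists>\<gamma><\<beta>. rk q < \<gamma>)"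
      unfolding sim_limit[OF limit.hyps] using limit by blast
    \<comment> \<open>At a limit, \<open>osuc (rk q)\<close> is still below \<open>\<beta>\<close>
      and serves as the witness.\<close>
    also have "\<dots> \<longleftrightarrow> rk q < \<beta>"
      using osuc_less_limit[OF limit.hyps(2)] less_osuc less_trans by blast
    finally show ?case .
  qed
  show ?thesis
  proof (rule that)
    show "Elem (e 1) \<in> closed_terms K2_eff" "Elem (e 0) \<in> closed_terms K2_eff"
      using e by (simp_all add: closed_terms_def K2_eff_simps)
    show "sim K2_eff (osuc \<alpha>) (Elem (e 1)) (Elem (e 0))" "\<not> sim K2_eff \<alpha> (Elem (e 1)) (Elem (e 0))"
      using main[of 1] w(3) by (simp_all add: rk_def less_osuc)
  qed
qed

section \<open>The Kleene--Brouwer order\<close>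

fun kb :: "nat list \<Rightarrow> nat list \<Rightarrow> bool" where
  "kb [] ys \<longleftrightarrow> False"
| "kb (x # xs) [] \<longleftrightarrow> True"
| "kb (x # xs) (y # ys) \<longleftrightarrow> x < y \<or> x = y \<and> kb xs ys"

lemma kb_irrefl: "\<not> kb xs xs"
  by (induction xs) auto

lemma kb_trans: "kb xs ys \<Longrightarrow> kb ys zs \<Longrightarrow> kb xs zs"
proof (induction xs ys arbitrary: zs rule: kb.induct)
  case (3 x xs y ys)
  then show ?case by (cases zs) auto
qed (auto elim: kb.elims)

lemma kb_total: "xs \<noteq> ys \<Longrightarrow> kb xs ys \<or> kb ys xs"
proof (induction xs ys rule: kb.induct)
  case (1 ys)
  then show ?case by (cases ys) auto
qed auto

lemma kb_append_same: "kb (zs @ xs) (zs @ ys) \<longleftrightarrow> kb xs ys"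
  by (induction zs) auto

lemma kb_append: "ys \<noteq> [] \<Longrightarrow> kb (xs @ ys) xs"
  by (induction xs) (auto simp: neq_Nil_conv)

text \<open>The first difference is located by a bounded quantifier, with entries read by
  \<open>hd (drop n xs)\<close>, so that decidability follows from the closure rules.\<close>

lemma kb_iff: "kb xs ys \<longleftrightarrow> (\<exists>n<Suc (length ys). n < length xs \<and>
    (\<forall>i<n. hd (drop i xs) = hd (drop i ys)) \<and> (n = length ys \<or> hd (drop n xs) < hd (drop n ys)))"
proof (induction xs ys rule: kb.induct)
  case (3 x xs y ys)
  show ?case
    unfolding kb.simps 3 by (subst (2) Ex_less_Suc2) (auto simp: All_less_Suc2)
qed auto

lemma decidable_kb [computable_intros]:
  assumes "computable f" "computable g"
  shows "decidable (\<lambda>x. kb (f x) (g x))"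
proof -
  have "decidable (\<lambda>z. kb (fst z) (snd z))"
    unfolding kb_iff by (intro computable_intros)
  then show ?thesis
    using decidable_comp[of "\<lambda>z. kb (fst z) (snd z)" "\<lambda>x. (f x, g x)"] assms
    by (simp add: computable_Pair)
qed

text \<open>A minimum is found by repeatedly fixing the least possible next entry. Without an
  infinite path this ends, at a node that is the only candidate left.\<close>

lemma wf_kb:
  assumes prefix: "\<And>l m. l @ m \<in> T \<Longrightarrow> l \<in> T" and path: "\<nexists>F. \<forall>n. map F [0..<n] \<in> T"
  shows "wf {(l, l'). l \<in> T \<and> l' \<in> T \<and> kb l l'}"
proof -
  define R where "R = {(l @ [x], l) | l x. l @ [x] \<in> T}"
  have "wf R"
    unfolding wf_iff_no_infinite_down_chain
  proof
    assume "\<exists>f. \<forall>i. (f (Suc i), f i) \<in> R"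
    then obtain f where f: "\<And>i. (f (Suc i), f i) \<in> R" by blast
    have fR: "\<exists>x. f (Suc i) = f i @ [x] \<and> f (Suc i) \<in> T" for i
      using f[of i] unfolding R_def mem_Collect_eq prod.inject by metis
    then obtain e where e: "\<And>i. f (Suc i) = f i @ [e i]" by metis
    define k where "k = length (f 0)"
    \<comment> \<open>The chain may start at any node; the entries of \<open>f 0\<close> fill the
      beginning of the path.\<close>
    define F where "F i = (if i < k then f 0 ! i else e (i - k))" for i
    have fF: "f i = map F [0..<k + i]" for i
    proof (induction i)
      case 0
      show ?case by (auto simp: F_def k_def intro: nth_equalityI)
    qed (simp add: e F_def)
    have "map F [0..<n] \<in> T" for n
    proof -
      have "map F [0..<n] = take n (f (Suc n))"
        unfolding fF by (simp add: take_map)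
      then show ?thesis using prefix fR[of n] by (metis append_take_drop_id)
    qed
    with path show False by blast
  qed
  have min: "\<exists>z\<in>Q. \<forall>y\<in>Q. \<not> kb y z" if "Q \<subseteq> T" "Q \<noteq> {}" "\<And>q. q \<in> Q \<Longrightarrow> \<exists>m. q = l @ m" for l Q
    using \<open>wf R\<close> that
  proof (induction l arbitrary: Q rule: wf_induct_rule)
    case (less l)
    show ?case
    proof (cases "Q \<subseteq> {l}")
      case True
      with less.prems show ?thesis using kb_irrefl by blast
    next
      case False
      then obtain q where "q \<in> Q" "q \<noteq> l" by blast
      then obtain m where "q = l @ m" "m \<noteq> []" using less.prems(3) by fastforce
      with \<open>q \<in> Q\<close> have "\<exists>x m. l @ x # m \<in> Q" by (metis neq_Nil_conv)
      define x where "x = (LEAST x. \<exists>m. l @ x # m \<in> Q)"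
      have x: "\<exists>m. l @ x # m \<in> Q"
        unfolding x_def by (rule LeastI_ex) fact
      have x_le: "x \<le> y" if "l @ y # m \<in> Q" for y m
        unfolding x_def by (rule Least_le) (use that in blast)
      define Q' where "Q' = {q \<in> Q. \<exists>m. q = l @ x # m}"
      have "l @ [x] \<in> T"
        using x less.prems(1) prefix[of "l @ [x]"] by auto
      then have "(l @ [x], l) \<in> R" by (auto simp: R_def)
      moreover have "Q' \<subseteq> T" "Q' \<noteq> {}" "\<And>q. q \<in> Q' \<Longrightarrow> \<exists>m. q = (l @ [x]) @ m"
        using less.prems x by (auto simp: Q'_def)
      ultimately obtain z where z: "z \<in> Q'" "\<forall>y\<in>Q'. \<not> kb y z"
        using less.IH by metis
      then obtain mz where mz: "z = l @ x # mz" by (auto simp: Q'_def)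
      have "\<not> kb y z" if y: "y \<in> Q" for y
      proof
        assume kb: "kb y z"
        obtain m where m: "y = l @ m" using less.prems(3) y by blast
        with kb mz have "kb m (x # mz)" by (simp add: kb_append_same)
        then obtain y0 m' where "m = y0 # m'" "y0 < x \<or> y0 = x \<and> kb m' mz"
          by (cases m) auto
        with x_le m y have "y0 = x" by fastforce
        with m y \<open>m = y0 # m'\<close> have "y \<in> Q'" by (auto simp: Q'_def)
        with z(2) kb show False by blast
      qed
      with z(1) show ?thesis by (auto simp: Q'_def)
    qed
  qed
  show ?thesis
    unfolding wf_eq_minimal
  proof (intro allI impI)
    fix Q and x :: "nat list"
    assume "x \<in> Q"
    show "\<exists>z\<in>Q. \<forall>y. (y, z) \<in> {(l, l'). l \<in> T \<and> l' \<in> T \<and> kb l l'} \<longrightarrow> y \<notin> Q"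
    proof (cases "Q \<inter> T = {}")
      case False
      then obtain z where "z \<in> Q \<inter> T" "\<forall>y\<in>Q \<inter> T. \<not> kb y z"
        using min[of "Q \<inter> T" "[]"] by auto
      then show ?thesis by blast
    qed (use \<open>x \<in> Q\<close> in blast)
  qed
qed

text \<open>The rank of a node is the type of its Kleene--Brouwer segment, which may exceed its rank
  in the tree but is computable at once. Extensions precede their prefixes, hence the strict
  decrease.\<close>

lemma computable_tree_rank:
  fixes T :: "nat list set"
  assumes dec: "decidable (\<lambda>l. l \<in> T)"
    and prefix: "\<And>l m. l @ m \<in> T \<Longrightarrow> l \<in> T" and path: "\<nexists>F. \<forall>n. map F [0..<n] \<in> T"
  obtains rk :: "nat list \<Rightarrow> 'o :: infinite ordinal"
  where "\<And>l. computable_ordinal (rk l)"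
    and "\<And>l m. l @ m \<in> T \<Longrightarrow> m \<noteq> [] \<Longrightarrow> rk (l @ m) < rk l"
proof -
  define w :: "nat rel" where
    "w = {(m, n). decode m \<in> T \<and> decode n \<in> T \<and> (m = n \<or> kb (decode m) (decode n))}"
  have decode_inj: "decode m = (decode n :: nat list) \<longleftrightarrow> m = n" for m n
    by (metis encode_decode)
  have F: "Field w = {n. decode n \<in> T}" by (auto simp: w_def Field_def)
  have "refl_on (Field w) w" unfolding F by (auto simp: refl_on_def w_def)
  moreover have "w \<subseteq> Field w \<times> Field w" by (auto simp: Field_def)
  moreover have "trans w" by (auto simp: trans_def w_def intro: kb_trans)
  moreover have "antisym w" using kb_trans kb_irrefl by (auto simp: antisym_def w_def)
  moreover have "total_on (Field w) w"
    unfolding F using kb_total decode_inj by (auto simp: total_on_def w_def)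
  moreover have "wf (w - Id)"
    by (rule wf_subset[OF wf_inv_image[where f = decode, OF wf_kb[OF prefix path]]])
      (auto simp: w_def inv_image_def)
  ultimately have w: "Well_order w" by (simp add: order_on_defs)
  have "decidable (\<lambda>z :: nat \<times> nat. decode (fst z) \<in> T \<and> decode (snd z) \<in> T \<and>
      (fst z = snd z \<or> kb (decode (fst z)) (decode (snd z))))"
    by (intro computable_intros decidable_comp[OF dec])
  moreover have "(\<lambda>z :: nat \<times> nat. decode (fst z) \<in> T \<and> decode (snd z) \<in> T \<and>
      (fst z = snd z \<or> kb (decode (fst z)) (decode (snd z)))) = (\<lambda>z. z \<in> w)"
    by (auto simp: w_def)
  ultimately have cw: "computable_rel w" by (simp add: computable_rel_iff)
  show ?thesis
  proof (rule that)
    show "computable_ordinal (orank w (encode l) :: 'o ordinal)" for l :: "nat list"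
      using computable_orank[OF w cw] .
    fix l m :: "nat list"
    assume "l @ m \<in> T" "m \<noteq> []"
    then have "(encode (l @ m), encode l) \<in> w"
      using prefix[of l m] kb_append by (simp add: w_def)
    then show "(orank w (encode (l @ m)) :: 'o ordinal) < orank w (encode l)"
      using \<open>m \<noteq> []\<close> by (intro orank_less[OF w]) auto
  qed
qed

section \<open>Certificates for computations\<close>

text \<open>With a positive tag, the content of a program code is smaller than the code; this
  supports induction on codes.\<close>

lemma less_prod_encode: "0 < m \<Longrightarrow> n < prod_encode (m, n)"
proof -
  assume "0 < m"
  have "k \<le> triangle k" for k by (induction k) simp_all
  then have "m + n \<le> triangle (m + n)" .
  with \<open>0 < m\<close> show ?thesis by (simp add: prod_encode_def)
qed

lemma less_encode_list: "x \<in> set xs \<Longrightarrow> x < encode xs" for x :: nat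
proof (induction xs)
  case (Cons y ys)
  have "y \<le> prod_encode (y, encode ys)" "encode ys \<le> prod_encode (y, encode ys)"
    by (simp_all add: le_prod_encode_1 le_prod_encode_2)
  with Cons show ?case by (auto simp: encode_Cons)
qed simp

primrec recf_code :: "recf \<Rightarrow> nat" where
  "recf_code Zero = encode (0 :: nat, 0 :: nat)"
| "recf_code Succ = encode (1 :: nat, 0 :: nat)"
| "recf_code (Proj i) = encode (2 :: nat, i)"
| "recf_code (Comp p qs) = encode (3 :: nat, encode (recf_code p, map recf_code qs))"
| "recf_code (PrimRec p q) = encode (4 :: nat, encode (recf_code p, recf_code q))"
| "recf_code (Mu p) = encode (5 :: nat, recf_code p)"

type_synonym judgement = "nat \<times> nat list \<times> nat"

text \<open>A judgement \<open>(e, xs, y)\<close> states that the program coded by \<open>e\<close> has the value \<open>y\<close> at \<open>xs\<close>.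
  The certificate \<open>J\<close> supplies the intermediate values of the rule applied.\<close>

definition cert_ok :: "judgement \<Rightarrow> nat \<Rightarrow> bool" where
  "cert_ok c J \<longleftrightarrow> (let (e, xs, y) = c; (tag, r) = decode e :: nat \<times> nat in
      tag = 0 \<and> y = 0 \<or>
      tag = 1 \<and> xs \<noteq> [] \<and> y = Suc (hd xs) \<or>
      tag = 2 \<and> r < length xs \<and> y = hd (drop r xs) \<or>
      tag = 3 \<and> length (decode J :: nat list) = length (snd (decode r :: nat \<times> nat list)) \<or>
      tag = 4 \<and> xs \<noteq> [] \<or>
      tag = 5 \<and> length (decode J :: nat list) = y)"

text \<open>\<open>J\<close> codes the inner values of a composition, is the preceding value of a
  primitive recursion, and codes the predecessors of the positive values that a minimisation
  passes.\<close>

definition premise :: "judgement \<Rightarrow> nat \<Rightarrow> judgement \<Rightarrow> bool" where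
  "premise c J c' \<longleftrightarrow> (let (e, xs, y) = c; (tag, r) = decode e :: nat \<times> nat in
      tag = 3 \<and> (let (p, qs) = decode r :: nat \<times> nat list in
          c' = (p, decode J, y) \<or> (\<exists>j<length qs. c' = (hd (drop j qs), xs, hd (drop j (decode J))))) \<or>
      tag = 4 \<and> (let (p, q) = decode r in
          if hd xs = 0 then c' = (p, tl xs, y)
          else c' = (e, (hd xs - 1) # tl xs, J) \<or> c' = (q, (hd xs - 1) # J # tl xs, y)) \<or>
      tag = 5 \<and> (c' = (r, y # xs, 0) \<or> (\<exists>m<y. c' = (r, m # xs, Suc (hd (drop m (decode J)))))))"

lemma decidable_cert_ok:
  assumes "computable f" "computable g"
  shows "decidable (\<lambda>x. cert_ok (f x) (g x))"
  unfolding cert_ok_def Let_def case_prod_beta using assms by (intro computable_intros)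

lemma decidable_premise:
  assumes "computable f" "computable g" "computable h"
  shows "decidable (\<lambda>x. premise (f x) (g x) (h x))"
proof -
  have "decidable (\<lambda>z. premise (fst z) (fst (snd z)) (snd (snd z)))"
    unfolding premise_def Let_def case_prod_beta by (intro computable_intros)
  from decidable_comp[OF this, of "\<lambda>x. (f x, g x, h x)"] show ?thesis
    using assms by (simp add: computable_Pair)
qed

definition provable :: "judgement \<Rightarrow> bool" where
  "provable c \<longleftrightarrow> (\<exists>p. fst c = recf_code p \<and> computes p (fst (snd c)) (snd (snd c)))"

text \<open>The certificate is read off the last rule of a derivation.\<close>

lemma provable_cert:
  assumes "provable c"
  shows "\<exists>J. cert_ok c J \<and> (\<forall>c'. premise c J c' \<longrightarrow> provable c')"
proof -
  obtain e xs y where c: "c = (e, xs, y)" by (cases c)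
  then obtain p where p: "e = recf_code p" "computes p xs y"
    using assms by (auto simp: provable_def)
  from p(2) show ?thesis
  proof cases
    case zero
    then show ?thesis by (simp add: c p(1) cert_ok_def premise_def)
  next
    case succ
    then show ?thesis by (simp add: c p(1) cert_ok_def premise_def)
  next
    case proj
    then show ?thesis by (simp add: c p(1) cert_ok_def premise_def hd_drop_conv_nth)
  next
    case (comp qs ys q)
    then show ?thesis
      by (intro exI[of _ "encode ys"])
        (auto simp: c p(1) cert_ok_def premise_def provable_def list_all2_conv_all_nth hd_drop_conv_nth)
  next
    case (primrec_0 p' xs' q)
    then show ?thesis by (auto simp: c p(1) cert_ok_def premise_def provable_def)
  next
    case (primrec_Suc p' q n xs' y')
    then have "provable (e, n # xs', y')"
      using p(1) unfolding provable_def by (intro exI[of _ p]) simp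
    with primrec_Suc show ?thesis
      by (intro exI[of _ y']) (auto simp: c p(1) cert_ok_def premise_def provable_def)
  next
    case (mu p')
    then obtain z where z: "\<And>m. m < y \<Longrightarrow> computes p' (m # xs) (Suc (z m))" by metis
    with mu show ?thesis
      by (intro exI[of _ "encode (map z [0..<y])"])
        (auto simp: c p(1) cert_ok_def premise_def provable_def hd_drop_conv_nth)
  qed
qed

text \<open>A set of judgements each of which is justified by others is sound, with no well-foundedness
  required of the justifications: every rule passes to a subprogram, or to the same \<open>PrimRec\<close>
  with a smaller first argument.\<close>

lemma certified_sound:
  fixes D :: "judgement \<Rightarrow> nat"
  assumes ok: "\<And>c J. D c = Suc J \<Longrightarrow> cert_ok c J"
    and prem: "\<And>c J c'. D c = Suc J \<Longrightarrow> premise c J c' \<Longrightarrow> 0 < D c'"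
  shows "\<exists>p. \<forall>xs y. 0 < D (e, xs, y) \<longrightarrow> computes p xs y"
\<comment> \<open>The program depends on \<open>e\<close> alone: one program for all inputs is what
  makes an argument computable. It is rebuilt from the certificates, as \<open>e\<close> may be the
  code of no program.\<close>
proof (induction e rule: less_induct)
  case (less e)
  obtain tag r :: nat where e: "decode e = (tag, r)" by fastforce
  then have "e = encode (tag, r)" by (metis encode_decode)
  then have e': "e = prod_encode (tag, r)" by (simp add: encode_pair)
  have ok': "\<And>xs y. 0 < D (e, xs, y) \<Longrightarrow> \<exists>J. D (e, xs, y) = Suc J \<and> cert_ok (e, xs, y) J"
    using ok gr0_implies_Suc by metis
  consider "tag = 0" | "tag = 1" | "tag = 2" | "tag = 3" | "tag = 4" | "tag = 5" | "tag \<ge> 6" by linarith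
  then show ?case
  proof cases
    case 1
    have "computes Zero xs y" if "0 < D (e, xs, y)" for xs y
      using ok'[OF that] 1 by (auto simp: cert_ok_def e intro: computes.zero)
    then show ?thesis by blast
  next
    case 2
    have "computes Succ xs y" if "0 < D (e, xs, y)" for xs y
      using ok'[OF that] 2 by (cases xs) (auto simp: cert_ok_def e intro: computes.succ)
    then show ?thesis by blast
  next
    case 3
    have "computes (Proj r) xs y" if "0 < D (e, xs, y)" for xs y
      using ok'[OF that] 3 by (auto simp: cert_ok_def e hd_drop_conv_nth intro: computes.proj)
    then show ?thesis by blast
  next
    case 4
    obtain p qs where r: "decode r = (p :: nat, qs :: nat list)" by fastforce
    then have "r = encode (p, qs)" by (metis encode_decode)
    then have r': "p \<le> r" "encode qs \<le> r"
      by (simp_all add: encode_pair le_prod_encode_1 le_prod_encode_2)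
    have "r < e" unfolding e' using 4 by (simp add: less_prod_encode)
    with r' less obtain p' where p': "\<And>xs y. 0 < D (p, xs, y) \<Longrightarrow> computes p' xs y" by (meson le_less_trans)
    have "\<forall>q\<in>set qs. \<exists>q'. \<forall>xs y. 0 < D (q, xs, y) \<longrightarrow> computes q' xs y"
      using less less_encode_list r'(2) \<open>r < e\<close> by (meson le_less_trans less_trans less_le_trans)
    then obtain f where f: "\<And>q xs y. q \<in> set qs \<Longrightarrow> 0 < D (q, xs, y) \<Longrightarrow> computes (f q) xs y" by metis
    have "computes (Comp p' (map f qs)) xs y" if pos: "0 < D (e, xs, y)" for xs y
    proof -
      obtain J where J: "D (e, xs, y) = Suc J" "cert_ok (e, xs, y) J" using ok'[OF pos] by blast
      define ys :: "nat list" where "ys = decode J"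
      have len: "length ys = length qs" using J(2) 4 by (simp add: cert_ok_def e r ys_def)
      have "0 < D (p, ys, y)"
        by (rule prem[OF J(1)]) (simp add: premise_def e r 4 ys_def)
      moreover have "0 < D (qs ! j, xs, ys ! j)" if "j < length qs" for j
        by (rule prem[OF J(1)]) (use that len in \<open>auto simp: premise_def e r 4 ys_def hd_drop_conv_nth\<close>)
      ultimately show ?thesis
        using p' f len by (intro computes.comp[of _ _ ys]) (auto simp: list_all2_conv_all_nth)
    qed
    then show ?thesis by blast
  next
    case 5
    obtain p q where r: "decode r = (p :: nat, q :: nat)" by fastforce
    then have "r = encode (p, q)" by (metis encode_decode)
    then have r': "p \<le> r" "q \<le> r"
      by (simp_all add: encode_pair le_prod_encode_1 le_prod_encode_2)
    have re: "r < e" unfolding e' using 5 by (simp add: less_prod_encode)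
    obtain p' where p': "\<And>xs y. 0 < D (p, xs, y) \<Longrightarrow> computes p' xs y"
      using less[OF le_less_trans[OF r'(1) re]] by blast
    obtain q' where q': "\<And>xs y. 0 < D (q, xs, y) \<Longrightarrow> computes q' xs y"
      using less[OF le_less_trans[OF r'(2) re]] by blast
    have *: "computes (PrimRec p' q') (n # xs) y" if "0 < D (e, n # xs, y)" for n xs y
      using that
    proof (induction n arbitrary: y)
      case 0
      then obtain J where J: "D (e, 0 # xs, y) = Suc J" using gr0_implies_Suc by blast
      have "0 < D (p, xs, y)"
        by (rule prem[OF J]) (simp add: premise_def e r 5)
      then show ?case by (intro computes.primrec_0 p')
    next
      case (Suc n)
      then obtain J where J: "D (e, Suc n # xs, y) = Suc J" using gr0_implies_Suc by blast
      have "0 < D (e, n # xs, J)"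
        by (rule prem[OF J]) (simp add: premise_def e r 5)
      moreover have "0 < D (q, n # J # xs, y)"
        by (rule prem[OF J]) (simp add: premise_def e r 5)
      ultimately show ?case by (intro computes.primrec_Suc[OF Suc.IH q'])
    qed
    have "computes (PrimRec p' q') xs y" if "0 < D (e, xs, y)" for xs y
      using ok'[OF that] * that 5 by (cases xs) (auto simp: cert_ok_def e)
    then show ?thesis by blast
  next
    case 6
    have "r < e" unfolding e' using 6 by (simp add: less_prod_encode)
    then obtain p' where p': "\<And>xs y. 0 < D (r, xs, y) \<Longrightarrow> computes p' xs y"
      using less by blast
    have "computes (Mu p') xs y" if pos: "0 < D (e, xs, y)" for xs y
    proof -
      obtain J where J: "D (e, xs, y) = Suc J" using ok'[OF pos] by blast
      have "0 < D (r, y # xs, 0)"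
        by (rule prem[OF J]) (simp add: premise_def e 6)
      moreover have "0 < D (r, m # xs, Suc (hd (drop m (decode J))))" if "m < y" for m
        by (rule prem[OF J]) (use that in \<open>auto simp: premise_def e 6\<close>)
      ultimately show ?thesis using p' by (blast intro: computes.mu)
    qed
    then show ?thesis by blast
  next
    case 7
    \<comment> \<open>No certificate exists for an unknown tag, so any program serves.\<close>
    have "computes Zero xs y" if "0 < D (e, xs, y)" for xs y
      using ok'[OF that] 7 by (auto simp: cert_ok_def e)
    then show ?thesis by blast
  qed
qed

section \<open>The tree of certified differences\<close>

text \<open>
  A witness is a function on triples \<open>(i, k, c)\<close>, where \<open>i\<close> is the number of arguments applied so
  far; the two sides of the comparison are numbered \<open>0\<close> and \<open>1\<close>.
  \<^item> \<open>(i, k, c)\<close> for \<open>k < 2\<close>: the value at \<open>c\<close> of side \<open>k\<close>, and the length of the query that produced it;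
  \<^item> \<open>(i + 1, 2, m)\<close>: the code of the first \<open>m\<close> values of the last argument;
  \<^item> \<open>(i, 3, 0)\<close>: an index of the last argument, for each side a flag that is \<open>0\<close> if it is defined and
    otherwise the successor of a point where it diverges, and a point where the two sides differ;
  \<^item> \<open>(0, 4, c)\<close>: \<open>0\<close>, or the successor of a justification of the judgement coded by \<open>c\<close>.

  Since the code of \<open>(i, k, c)\<close> is at least \<open>i\<close>, the first \<open>n + 1\<close> values of a witness depend on the
  first \<open>n\<close> arguments only.
\<close>

definition pos :: "nat \<Rightarrow> nat \<Rightarrow> nat \<Rightarrow> nat" where
  "pos i k c = encode (i, k, c)"

definition undef_flag :: "nat \<Rightarrow> nat \<Rightarrow> nat" where
  "undef_flag k v = (let (e, u, u', j) = decode v :: nat \<times> nat \<times> nat \<times> nat in if k = 0 then u else u')"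

definition index_of :: "nat \<Rightarrow> nat" where
  "index_of v = fst (decode v :: nat \<times> nat \<times> nat \<times> nat)"

definition diff_of :: "nat \<Rightarrow> nat" where
  "diff_of v = snd (snd (snd (decode v :: nat \<times> nat \<times> nat \<times> nat)))"

definition value_of :: "nat \<Rightarrow> nat" where
  "value_of v = fst (decode v :: nat \<times> nat)"

definition modulus_of :: "nat \<Rightarrow> nat" where
  "modulus_of v = snd (decode v :: nat \<times> nat)"

lemma computable_pos [computable_intros]:
  "computable f \<Longrightarrow> computable g \<Longrightarrow> computable h \<Longrightarrow> computable (\<lambda>x. pos (f x) (g x) (h x))"
  unfolding pos_def by (intro computable_intros)

lemma computable_undef_flag [computable_intros]:
  "computable f \<Longrightarrow> computable g \<Longrightarrow> computable (\<lambda>x. undef_flag (f x) (g x))"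
  unfolding undef_flag_def Let_def case_prod_beta by (intro computable_intros)

lemma computable_fields [computable_intros]:
  assumes "computable f"
  shows "computable (\<lambda>x. index_of (f x))" "computable (\<lambda>x. diff_of (f x))"
    "computable (\<lambda>x. value_of (f x))" "computable (\<lambda>x. modulus_of (f x))"
  unfolding index_of_def diff_of_def value_of_def modulus_of_def
  by (intro computable_intros assms)+

text \<open>All clauses are relativised to positions below \<open>n\<close>, so that they can be tested on the
  initial segment of length \<open>n\<close>.\<close>

definition step_rel :: "nat \<Rightarrow> nat \<Rightarrow> nat \<Rightarrow> nat \<Rightarrow> nat \<Rightarrow> nat \<Rightarrow> nat \<Rightarrow> bool" where
  "step_rel k c m h h' v y \<longleftrightarrow>
    (undef_flag k h = 0 \<longrightarrow> undef_flag k h' = 0 \<and>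
      (m < modulus_of v \<longrightarrow> value_of y = 0) \<and> (m = modulus_of v \<longrightarrow> value_of y = Suc (value_of v))) \<and>
    (undef_flag k h = Suc c \<longrightarrow> undef_flag k h' = 0 \<longrightarrow> value_of y = 0)"

text \<open>A list code is the successor of a pair code, so
  \<open>Suc (encode (c, F (pos (Suc i) 2 m)))\<close> is the query made of the point
  \<open>c\<close> and the first \<open>m\<close> values of the argument; the old value of side
  \<open>k\<close> there is the answer.\<close>

definition step_ok :: "(nat \<Rightarrow> nat) \<Rightarrow> nat \<Rightarrow> bool" where
  "step_ok F n \<longleftrightarrow> (\<forall>i<n. \<forall>k<2. \<forall>c<n. \<forall>m<n.
    pos (Suc i) 2 m < n \<longrightarrow> pos i k (Suc (encode (c, F (pos (Suc i) 2 m)))) < n \<longrightarrow>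
    pos (Suc i) k c < n \<longrightarrow> pos (Suc i) 3 0 < n \<longrightarrow> pos i 3 0 < n \<longrightarrow>
    step_rel k c m (F (pos (Suc i) 3 0)) (F (pos i 3 0)) (F (pos (Suc i) k c))
      (F (pos i k (Suc (encode (c, F (pos (Suc i) 2 m)))))))"

text \<open>Two undefined sides would agree, and one undefined side alone already makes a
  difference.\<close>

definition diff_rel :: "nat \<Rightarrow> nat \<Rightarrow> nat \<Rightarrow> bool" where
  "diff_rel h v v' \<longleftrightarrow> (undef_flag 0 h = 0 \<or> undef_flag 1 h = 0) \<and>
    (undef_flag 0 h = 0 \<longrightarrow> undef_flag 1 h = 0 \<longrightarrow> value_of v \<noteq> value_of v')"

definition diff_ok :: "(nat \<Rightarrow> nat) \<Rightarrow> nat \<Rightarrow> bool" where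
  "diff_ok F n \<longleftrightarrow> (\<forall>i<n. pos i 3 0 < n \<longrightarrow>
    pos i 0 (diff_of (F (pos i 3 0))) < n \<longrightarrow> pos i 1 (diff_of (F (pos i 3 0))) < n \<longrightarrow>
    diff_rel (F (pos i 3 0)) (F (pos i 0 (diff_of (F (pos i 3 0))))) (F (pos i 1 (diff_of (F (pos i 3 0))))))"

text \<open>Segments of different lengths are not compared directly: their entries are certified for
  one index, and uniqueness of values makes them cohere.\<close>

definition input_ok :: "(nat \<Rightarrow> nat) \<Rightarrow> nat \<Rightarrow> bool" where
  "input_ok F n \<longleftrightarrow> (\<forall>i<n. \<forall>m<n. pos (Suc i) 2 m < n \<longrightarrow> pos (Suc i) 3 0 < n \<longrightarrow>
    length (decode (F (pos (Suc i) 2 m)) :: nat list) = m \<and>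
    (\<forall>t<m. let c = encode (index_of (F (pos (Suc i) 3 0)), [t], hd (drop t (decode (F (pos (Suc i) 2 m)) :: nat list))) in
      pos 0 4 c < n \<longrightarrow> 0 < F (pos 0 4 c)))"

definition cert_tree_ok :: "(nat \<Rightarrow> nat) \<Rightarrow> nat \<Rightarrow> bool" where
  "cert_tree_ok F n \<longleftrightarrow> (\<forall>c<n. \<forall>c'<n. pos 0 4 c < n \<longrightarrow> pos 0 4 c' < n \<longrightarrow> 0 < F (pos 0 4 c) \<longrightarrow>
    cert_ok (decode c) (F (pos 0 4 c) - 1) \<and>
    (premise (decode c) (F (pos 0 4 c) - 1) (decode c') \<longrightarrow> 0 < F (pos 0 4 c')))"

definition init_ok :: "(nat \<Rightarrow> (nat \<Rightarrow> nat) option) \<Rightarrow> (nat \<Rightarrow> nat) \<Rightarrow> nat \<Rightarrow> bool" where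
  "init_ok a F n \<longleftrightarrow> (\<forall>k<2. \<forall>c<n. pos 0 k c < n \<longrightarrow> pos 0 3 0 < n \<longrightarrow>
    (undef_flag k (F (pos 0 3 0)) = 0 \<longleftrightarrow> a k \<noteq> None) \<and>
    (case a k of None \<Rightarrow> True | Some f \<Rightarrow> value_of (F (pos 0 k c)) = f c))"

definition tree_ok :: "(nat \<Rightarrow> (nat \<Rightarrow> nat) option) \<Rightarrow> (nat \<Rightarrow> nat) \<Rightarrow> nat \<Rightarrow> bool" where
  "tree_ok a F n \<longleftrightarrow> init_ok a F n \<and> step_ok F n \<and> diff_ok F n \<and> input_ok F n \<and> cert_tree_ok F n"

definition diff_tree :: "(nat \<Rightarrow> (nat \<Rightarrow> nat) option) \<Rightarrow> nat list set" where
  "diff_tree a = {l. tree_ok a (\<lambda>p. hd (drop p l)) (length l)}"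

lemma tree_ok_cong:
  assumes "\<And>p. p < n \<Longrightarrow> F p = G p"
  shows "tree_ok a F n \<longleftrightarrow> tree_ok a G n"
proof -
  have "init_ok a F n \<longleftrightarrow> init_ok a G n" unfolding init_ok_def using assms by (simp cong: option.case_cong)
  moreover have "step_ok F n \<longleftrightarrow> step_ok G n" unfolding step_ok_def using assms by simp
  moreover have "diff_ok F n \<longleftrightarrow> diff_ok G n" unfolding diff_ok_def using assms by simp
  moreover have "input_ok F n \<longleftrightarrow> input_ok G n" unfolding input_ok_def Let_def using assms by simp
  moreover have "cert_tree_ok F n \<longleftrightarrow> cert_tree_ok G n" unfolding cert_tree_ok_def using assms by simp
  ultimately show ?thesis by (simp add: tree_ok_def)
qed

lemma tree_ok_mono:
  assumes ok: "tree_ok a F n" and "m \<le> n"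
  shows "tree_ok a F m"
proof -
  have less: "\<And>p. p < m \<Longrightarrow> p < n" using \<open>m \<le> n\<close> by simp
  have "init_ok a F m" using ok less unfolding tree_ok_def init_ok_def by blast
  moreover have "step_ok F m" using ok less unfolding tree_ok_def step_ok_def by blast
  moreover have "diff_ok F m" using ok less unfolding tree_ok_def diff_ok_def by blast
  moreover have "input_ok F m" using ok less unfolding tree_ok_def input_ok_def Let_def by blast
  moreover have "cert_tree_ok F m" using ok less unfolding tree_ok_def cert_tree_ok_def by blast
  ultimately show ?thesis by (simp add: tree_ok_def)
qed

lemma diff_tree_map: "map F [0..<n] \<in> diff_tree a \<longleftrightarrow> tree_ok a F n"
  unfolding diff_tree_def
  using tree_ok_cong[of n "\<lambda>p. hd (drop p (map F [0..<n]))" F a] by (simp add: hd_drop_conv_nth)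

lemma diff_tree_prefix: "l @ m \<in> diff_tree a \<Longrightarrow> l \<in> diff_tree a"
proof -
  assume "l @ m \<in> diff_tree a"
  then have "tree_ok a (\<lambda>p. hd (drop p (l @ m))) (length l)"
    unfolding diff_tree_def by (auto intro: tree_ok_mono)
  then show ?thesis
    unfolding diff_tree_def
    using tree_ok_cong[of "length l" "\<lambda>p. hd (drop p (l @ m))" "\<lambda>p. hd (drop p l)" a]
    by (simp add: hd_append)
qed

lemma decidable_diff_tree:
  assumes "\<And>k f. a k = Some f \<Longrightarrow> computable f"
  shows "decidable (\<lambda>l. l \<in> diff_tree a)"
proof -
  have "decidable (\<lambda>l. step_ok (\<lambda>p. hd (drop p l)) (length l))"
    unfolding step_ok_def step_rel_def by (intro computable_intros)
  moreover have "decidable (\<lambda>l. diff_ok (\<lambda>p. hd (drop p l)) (length l))"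
    unfolding diff_ok_def diff_rel_def by (intro computable_intros)
  moreover have "decidable (\<lambda>l. input_ok (\<lambda>p. hd (drop p l)) (length l))"
    unfolding input_ok_def Let_def by (intro computable_intros)
  moreover have "decidable (\<lambda>l. cert_tree_ok (\<lambda>p. hd (drop p l)) (length l))"
    unfolding cert_tree_ok_def by (intro computable_intros decidable_cert_ok decidable_premise)
  moreover have "decidable (\<lambda>l. init_ok a (\<lambda>p. hd (drop p l)) (length l))"
  proof -
    have all2: "(\<forall>k<2. P k) \<longleftrightarrow> P 0 \<and> P 1" for P :: "nat \<Rightarrow> bool"
      by (auto simp: numeral_2_eq_2 less_Suc_eq)
    \<comment> \<open>The split on \<open>a k\<close> is made outside the program, once for each of
      the two sides.\<close>
    have case_a: "decidable (\<lambda>x. case a k of None \<Rightarrow> True | Some f \<Rightarrow> value_of (v x) = f (c x))"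
      if "computable v" "computable c" for k and v c :: "nat list \<times> nat \<Rightarrow> nat"
    proof (cases "a k")
      case (Some f)
      then have f: "computable f" by (rule assms)
      show ?thesis unfolding Some option.case using that by (intro computable_intros computable_comp[OF f])
    qed (simp add: computable_intros)
    then show ?thesis unfolding init_ok_def all2 by (intro computable_intros case_a)
  qed
  ultimately show ?thesis
    unfolding diff_tree_def mem_Collect_eq tree_ok_def by (intro computable_intros)
qed

section \<open>Iterated application expressed by single queries\<close>

fun app_val :: "(nat \<Rightarrow> nat) option \<Rightarrow> (nat \<Rightarrow> nat \<Rightarrow> nat) \<Rightarrow> nat \<Rightarrow> (nat \<Rightarrow> nat) option" where
  "app_val b X 0 = b"
| "app_val b X (Suc i) = Option.bind (app_val b X i) (\<lambda>f. K2_app f (X i))"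

lemma app_val_cong: "(\<And>j. j < i \<Longrightarrow> X j = Y j) \<Longrightarrow> app_val b X i = app_val b Y i"
  by (induction i) auto

text \<open>This is the local form that \<open>step_rel\<close> tests, with the modulus as the
  witness \<open>m\<close>.\<close>

lemma K2_app_eq_Some_iff:
  "K2_app f x = Some g \<longleftrightarrow>
    (\<forall>c. \<exists>m. K2_query f x c m = Suc (g c) \<and> (\<forall>m'<m. K2_query f x c m' = 0))" (is "?L \<longleftrightarrow> ?R")
proof
  assume L: ?L
  show ?R
  proof (intro allI exI conjI impI)
    fix c
    have ex: "\<exists>k. 0 < K2_query f x c k" using L by (auto simp: K2_app_def split: if_splits)
    show "K2_query f x c (LEAST k. 0 < K2_query f x c k) = Suc (g c)"
      using L LeastI_ex[OF ex] by (auto simp: K2_app_def split: if_splits)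
    fix m assume "m < (LEAST k. 0 < K2_query f x c k)"
    then show "K2_query f x c m = 0" using not_less_Least by blast
  qed
next
  assume R: ?R
  then have ex: "\<forall>c. \<exists>k. 0 < K2_query f x c k" by (metis zero_less_Suc)
  have "K2_query f x c (LEAST k. 0 < K2_query f x c k) - 1 = g c" for c
  proof -
    obtain m where m: "K2_query f x c m = Suc (g c)" "\<forall>m'<m. K2_query f x c m' = 0" using R by blast
    have "(LEAST k. 0 < K2_query f x c k) = m"
      by (rule Least_equality) (use m in \<open>auto simp: not_less[symmetric]\<close>)
    with m show ?thesis by simp
  qed
  with ex show ?L by (simp add: K2_app_def)
qed

lemma K2_app_None_iff: "K2_app f x = None \<longleftrightarrow> (\<exists>c. \<forall>m. K2_query f x c m = 0)"
  by (auto simp: K2_app_def)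

lemma K2_query_encode: "K2_query f x c m = f (Suc (encode (c, encode (map x [0..<m]))))"
  by (simp add: K2_query_def encode_pair encode_nat_list)

lemma diff_tree_path:
  assumes "\<And>n. map F [0..<n] \<in> diff_tree a"
  obtains X where "\<And>i. computable (X i)" "\<And>i. app_val (a 0) X i \<noteq> app_val (a 1) X i"
proof -
  have ok: "init_ok a F n" "step_ok F n" "diff_ok F n" "input_ok F n" "cert_tree_ok F n" for n
    using assms by (auto simp: diff_tree_map tree_ok_def)
  define D where "D c = F (pos 0 4 (encode c))" for c :: judgement
  \<comment> \<open>Every clause holds for every bound, so it is instantiated at one exceeding all
    positions it mentions.\<close>
  have cert: "cert_ok c J \<and> (premise c J c' \<longrightarrow> 0 < D c')" if "D c = Suc J" for c J c'
    using ok(5)[of "Suc (encode c + encode c' + pos 0 4 (encode c) + pos 0 4 (encode c'))",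
        unfolded cert_tree_ok_def, THEN spec, of "encode c", THEN mp, THEN spec, of "encode c'"] that
    unfolding D_def by simp
  have sound: "\<exists>p. \<forall>xs y. 0 < D (e, xs, y) \<longrightarrow> computes p xs y" for e
    using certified_sound[of D e] cert by blast
  define W where "W i m = (decode (F (pos (Suc i) 2 m)) :: nat list)" for i m
  define e where "e i = index_of (F (pos (Suc i) 3 0))" for i
  \<comment> \<open>The value at \<open>t\<close> is the last entry of the segment of length
    \<open>t + 1\<close>; agreement with the other segments comes from
    \<open>computes_fun\<close>.\<close>
  define X where "X i t = W i (Suc t) ! t" for i t
  have len: "length (W i m) = m" for i m
    using ok(4)[of "Suc (i + m + pos (Suc i) 2 m + pos (Suc i) 3 0)",
        unfolded input_ok_def, THEN spec, of i, THEN mp, THEN spec, of m]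
    unfolding W_def by simp
  have cert_W: "0 < D (e i, [t], W i m ! t)" if "t < m" for i m t
  proof -
    have "W i m ! t = hd (drop t (W i m))" using that len by (simp add: hd_drop_conv_nth)
    then show ?thesis
      using ok(4)[of "Suc (i + m + pos (Suc i) 2 m + pos (Suc i) 3 0 + pos 0 4 (encode (e i, [t], W i m ! t)))",
          unfolded input_ok_def, THEN spec, of i, THEN mp, THEN spec, of m] that
      unfolding D_def e_def Let_def by (simp flip: W_def)
  qed
  have X: "computable (X i) \<and> (\<forall>m. W i m = map (X i) [0..<m])" for i
  proof -
    obtain p where p: "\<And>xs y. 0 < D (e i, xs, y) \<Longrightarrow> computes p xs y" using sound by blast
    have Xp: "computes p [t] (X i t)" for t
      unfolding X_def by (intro p cert_W) simp
    have "W i m ! t = X i t" if "t < m" for m t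
      using computes_fun[OF p[OF cert_W[OF that]] Xp] .
    then have "W i m = map (X i) [0..<m]" for m
      by (intro nth_equalityI) (simp_all add: len)
    moreover have "computable (X i)" unfolding computable_def using Xp by auto
    ultimately show ?thesis by blast
  qed
  have F_in: "F (pos (Suc i) 2 m) = encode (map (X i) [0..<m])" for i m
    using X[of i] by (metis W_def encode_decode)
  define g where "g i k c = value_of (F (pos i k c))" for i k c
  define u where "u i k = undef_flag k (F (pos i 3 0))" for i k
  have step: "(u (Suc i) k = 0 \<longrightarrow> u i k = 0 \<and>
        (m < modulus_of (F (pos (Suc i) k c)) \<longrightarrow> K2_query (g i k) (X i) c m = 0) \<and>
        (m = modulus_of (F (pos (Suc i) k c)) \<longrightarrow> K2_query (g i k) (X i) c m = Suc (g (Suc i) k c))) \<and>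
      (u (Suc i) k = Suc c \<longrightarrow> u i k = 0 \<longrightarrow> K2_query (g i k) (X i) c m = 0)" if "k < 2" for i k c m
    using ok(2)[of "Suc (i + c + m + pos (Suc i) 2 m + pos i k (Suc (encode (c, F (pos (Suc i) 2 m)))) +
      pos (Suc i) k c + pos (Suc i) 3 0 + pos i 3 0)", unfolded step_ok_def, rule_format, of i k c m] that
    unfolding K2_query_encode g_def u_def F_in step_rel_def by simp
  \<comment> \<open>Flag 0 supplies a modulus and a value at every point; flag \<open>Suc c\<close>
    supplies the point \<open>c\<close> where all queries fail, unless the side was undefined
    before.\<close>
  have vals: "(u i k = 0 \<longrightarrow> app_val (a k) X i = Some (g i k)) \<and> (0 < u i k \<longrightarrow> app_val (a k) X i = None)"
    if k: "k < 2" for i k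
  proof (induction i)
    case 0
    have "(u 0 k = 0 \<longleftrightarrow> a k \<noteq> None) \<and> (case a k of None \<Rightarrow> True | Some f \<Rightarrow> g 0 k c = f c)" for c
      using ok(1)[of "Suc (c + pos 0 k c + pos 0 3 0)", unfolded init_ok_def, rule_format, of k c] k
      unfolding g_def u_def by simp
    then show ?case by (auto simp: fun_eq_iff split: option.splits)
  next
    case (Suc i)
    show ?case
    proof (cases "u (Suc i) k")
      case 0
      then have "u i k = 0" using step[OF k, of i] by blast
      moreover have "K2_app (g i k) (X i) = Some (g (Suc i) k)"
        unfolding K2_app_eq_Some_iff using step[OF k, of i] 0 by blast
      ultimately show ?thesis using Suc 0 by simp
    next
      case c: (Suc c)
      show ?thesis
      proof (cases "u i k")
        case 0
        then have "K2_app (g i k) (X i) = None"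
          unfolding K2_app_None_iff using step[OF k, of i _ c] c 0 by blast
        then show ?thesis using Suc 0 c by simp
      qed (use Suc c in simp)
    qed
  qed
  have "app_val (a 0) X i \<noteq> app_val (a 1) X i" for i
  proof -
    define j where "j = diff_of (F (pos i 3 0))"
    have "(u i 0 = 0 \<or> u i 1 = 0) \<and> (u i 0 = 0 \<longrightarrow> u i 1 = 0 \<longrightarrow> g i 0 j \<noteq> g i 1 j)"
      using ok(3)[of "Suc (i + pos i 3 0 + pos i 0 j + pos i 1 j)", unfolded diff_ok_def, rule_format, of i]
      unfolding g_def u_def j_def diff_rel_def by simp
    then show ?thesis using vals[of 0 i] vals[of 1 i] by (cases "u i 0"; cases "u i 1") auto
  qed
  with X that show ?thesis by blast
qed

text \<open>The choices are not effective; only membership of the resulting lists in a decidable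
  tree matters. Certificates cover all provable judgements, so they do not depend on
  \<open>X\<close> and can sit at level 0. The flag of an undefined side is a successor even when
  the side was undefined earlier and no point is to be named.\<close>

definition witness :: "(nat \<Rightarrow> (nat \<Rightarrow> nat) option) \<Rightarrow> (nat \<Rightarrow> nat \<Rightarrow> nat) \<Rightarrow> nat \<times> nat \<times> nat \<Rightarrow> nat" where
  "witness a X z = (case z of (i, k, c) \<Rightarrow>
    if k < 2 then
      (case app_val (a k) X i of None \<Rightarrow> 0
       | Some f \<Rightarrow> encode (f c, case i of 0 \<Rightarrow> 0
          | Suc i' \<Rightarrow> LEAST m. 0 < K2_query (the (app_val (a k) X i')) (X i') c m))
    else if k = 2 then (case i of 0 \<Rightarrow> 0 | Suc i' \<Rightarrow> encode (map (X i') [0..<c]))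
    else if k = 3 then
      (let flag = (\<lambda>k. case app_val (a k) X i of Some f \<Rightarrow> 0
          | None \<Rightarrow> Suc (case i of 0 \<Rightarrow> 0
              | Suc i' \<Rightarrow> SOME c. \<forall>m. K2_query (the (app_val (a k) X i')) (X i') c m = 0))
       in encode (case i of 0 \<Rightarrow> 0 | Suc i' \<Rightarrow> recf_code (SOME p. \<forall>t. computes p [t] (X i' t)), flag 0, flag 1,
          SOME j. the (app_val (a 0) X i) j \<noteq> the (app_val (a 1) X i) j))
    else if provable (decode c) then
      Suc (SOME J. cert_ok (decode c) J \<and> (\<forall>c'. premise (decode c) J c' \<longrightarrow> provable c'))
    else 0)"

text \<open>This lets the next argument be chosen without disturbing the node already
  reached.\<close>

lemma witness_cong:
  assumes "\<And>j. j < i \<Longrightarrow> X j = Y j"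
  shows "witness a X (i, k, c) = witness a Y (i, k, c)"
proof (cases i)
  case 0
  then have "app_val b X i = app_val b Y i" for b by simp
  then show ?thesis using 0 unfolding witness_def Let_def by (simp split: option.split)
next
  case (Suc i')
  have "app_val b X i = app_val b Y i" "app_val b X i' = app_val b Y i'" for b
    by (rule app_val_cong, simp add: assms Suc)+
  moreover have "X i' = Y i'" using assms Suc by simp
  ultimately show ?thesis using Suc unfolding witness_def Let_def by (simp del: app_val.simps cong: option.case_cong)
qed

lemma witness_value:
  "k < 2 \<Longrightarrow> app_val (a k) X i = Some f \<Longrightarrow> value_of (witness a X (i, k, c)) = f c"
  by (simp add: witness_def value_of_def)

lemma witness_modulus:
  "k < 2 \<Longrightarrow> app_val (a k) X (Suc i) = Some h \<Longrightarrow> modulus_of (witness a X (Suc i, k, c)) =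
    (LEAST m. 0 < K2_query (the (app_val (a k) X i)) (X i) c m)"
  by (simp add: witness_def modulus_of_def del: app_val.simps)

lemma witness_input: "witness a X (Suc i, 2, m) = encode (map (X i) [0..<m])"
  by (simp add: witness_def)

lemma witness_flag_eq_0_iff:
  "k < 2 \<Longrightarrow> undef_flag k (witness a X (i, 3, 0)) = 0 \<longleftrightarrow> app_val (a k) X i \<noteq> None"
  by (cases "k = 0") (auto simp: witness_def undef_flag_def less_2_cases_iff split: option.splits)

lemma witness_flag_Suc:
  "k < 2 \<Longrightarrow> app_val (a k) X (Suc i) = None \<Longrightarrow> undef_flag k (witness a X (Suc i, 3, 0)) =
    Suc (SOME c. \<forall>m. K2_query (the (app_val (a k) X i)) (X i) c m = 0)"
  by (cases "k = 0") (auto simp: witness_def undef_flag_def less_2_cases_iff simp del: app_val.simps)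

lemma witness_index:
  "index_of (witness a X (Suc i, 3, 0)) = recf_code (SOME p. \<forall>t. computes p [t] (X i t))"
  by (simp add: witness_def index_of_def del: app_val.simps)

lemma witness_diff:
  "diff_of (witness a X (i, 3, 0)) = (SOME j. the (app_val (a 0) X i) j \<noteq> the (app_val (a 1) X i) j)"
  by (simp add: witness_def diff_of_def del: app_val.simps)

lemma witness_cert:
  "witness a X (0, 4, c) = (if provable (decode c) then
      Suc (SOME J. cert_ok (decode c) J \<and> (\<forall>c'. premise (decode c) J c' \<longrightarrow> provable c')) else 0)"
  by (simp add: witness_def)

lemma le_pos: "i \<le> pos i k c"
  by (simp add: pos_def encode_pair le_prod_encode_1)

lemma witness_tree_ok:
  assumes comp: "\<And>j. j < n \<Longrightarrow> computable (X j)"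
    and ne: "\<And>i. i \<le> n \<Longrightarrow> app_val (a 0) X i \<noteq> app_val (a 1) X i"
  shows "tree_ok a (\<lambda>p. witness a X (decode p)) (Suc n)" (is "tree_ok a ?F _")
proof -
  have F: "?F (pos i k c) = witness a X (i, k, c)" for i k c
    by (simp add: pos_def)
  \<comment> \<open>A list of length \<open>n + 1\<close> has positions up to \<open>n\<close>,
    hence levels up to \<open>n\<close>, which read only arguments below \<open>n\<close>.\<close>
  have level: "i \<le> n" if "pos i k c < Suc n" for i k c
    using le_pos[of i k c] that by simp
  have "init_ok a ?F (Suc n)"
    unfolding init_ok_def F
    by (auto simp: witness_flag_eq_0_iff witness_value split: option.split)
  moreover have "step_rel k c m (witness a X (Suc i, 3, 0)) (witness a X (i, 3, 0)) (witness a X (Suc i, k, c))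
      (witness a X (i, k, Suc (encode (c, witness a X (Suc i, 2, m)))))" if k: "k < 2" for i k c m
  proof (cases "app_val (a k) X (Suc i)")
    case None
    show ?thesis
    proof (cases "app_val (a k) X i")
      case (Some f)
      with None have "\<exists>c. \<forall>m. K2_query f (X i) c m = 0" by (simp add: K2_app_None_iff)
      then have "\<forall>m. K2_query f (X i) (SOME c. \<forall>m. K2_query f (X i) c m = 0) m = 0"
        by (rule someI_ex)
      then show ?thesis
        using Some witness_flag_Suc[where a = a and k = k, OF k None]
        by (auto simp: step_rel_def witness_value[where a = a and k = k, OF k Some] witness_input K2_query_encode)
    qed (use k None in \<open>auto simp: step_rel_def witness_flag_eq_0_iff\<close>)
  next
    case h: (Some h)
    then obtain f where f: "app_val (a k) X i = Some f" "K2_app f (X i) = Some h"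
      by (auto simp: bind_eq_Some_conv)
    obtain m0 where m0: "K2_query f (X i) c m0 = Suc (h c)" "\<forall>m'<m0. K2_query f (X i) c m' = 0"
      using f(2) unfolding K2_app_eq_Some_iff by blast
    have "(LEAST m. 0 < K2_query f (X i) c m) = m0"
      by (rule Least_equality) (use m0 in \<open>auto simp: not_less[symmetric]\<close>)
    then have "modulus_of (witness a X (Suc i, k, c)) = m0"
      using witness_modulus[where a = a and k = k, OF k h] f(1) by simp
    moreover have "undef_flag k (witness a X (Suc i, 3, 0)) = 0" "undef_flag k (witness a X (i, 3, 0)) = 0"
      using k f(1) h by (simp_all add: witness_flag_eq_0_iff del: app_val.simps)
    moreover have "value_of (witness a X (i, k, Suc (encode (c, witness a X (Suc i, 2, m))))) =
        K2_query f (X i) c m"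
      by (simp add: witness_value[where a = a and k = k, OF k f(1)] witness_input K2_query_encode)
    ultimately show ?thesis
      using m0 by (auto simp: step_rel_def witness_value[where a = a and k = k, OF k h])
  qed
  then have "step_ok ?F (Suc n)"
    unfolding step_ok_def F by blast
  moreover have "diff_rel (witness a X (i, 3, 0)) (witness a X (i, 0, diff_of (witness a X (i, 3, 0))))
      (witness a X (i, 1, diff_of (witness a X (i, 3, 0))))" if i: "i \<le> n" for i
  proof (cases "app_val (a 0) X i = None \<or> app_val (a 1) X i = None")
    case False
    then obtain f g where fg: "app_val (a 0) X i = Some f" "app_val (a 1) X i = Some g" by auto
    with ne[OF i] have "\<exists>j. f j \<noteq> g j" by auto
    then have "f (SOME j. f j \<noteq> g j) \<noteq> g (SOME j. f j \<noteq> g j)" by (rule someI_ex)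
    with fg show ?thesis
      using witness_value[of 0 a X i] witness_value[of 1 a X i]
      by (simp add: diff_rel_def witness_flag_eq_0_iff witness_diff)
  qed (use ne[OF i] in \<open>auto simp: diff_rel_def witness_flag_eq_0_iff\<close>)
  then have "diff_ok ?F (Suc n)"
    unfolding diff_ok_def F using level by blast
  moreover have "input_ok ?F (Suc n)"
    unfolding input_ok_def F Let_def
  proof (intro allI impI conjI)
    fix i m t
    show "length (decode (witness a X (Suc i, 2, m)) :: nat list) = m"
      by (simp add: witness_input)
    assume "pos (Suc i) 2 m < Suc n" "t < m"
    then have "computable (X i)" using level comp by fastforce
    then have "\<exists>p. \<forall>t. computes p [t] (X i t)" by (simp add: computable_def)
    then have "\<forall>t. computes (SOME p. \<forall>t. computes p [t] (X i t)) [t] (X i t)" by (rule someI_ex)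
    then have "provable (index_of (witness a X (Suc i, 3, 0)), [t], X i t)"
      unfolding provable_def witness_index by auto
    moreover have "hd (drop t (decode (witness a X (Suc i, 2, m)))) = X i t"
      using \<open>t < m\<close> by (simp add: witness_input hd_drop_conv_nth)
    ultimately show "0 < witness a X (0, 4, encode (index_of (witness a X (Suc i, 3, 0)), [t],
        hd (drop t (decode (witness a X (Suc i, 2, m)) :: nat list))))"
      by (simp add: witness_cert)
  qed
  moreover have "cert_tree_ok ?F (Suc n)"
    unfolding cert_tree_ok_def F
  proof (intro allI impI)
    fix c c'
    assume "0 < witness a X (0, 4, c)"
    then have prov: "provable (decode c)" by (auto simp: witness_cert split: if_splits)
    define J where "J = (SOME J. cert_ok (decode c) J \<and> (\<forall>c'. premise (decode c) J c' \<longrightarrow> provable c'))"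
    have J: "cert_ok (decode c) J \<and> (\<forall>c'. premise (decode c) J c' \<longrightarrow> provable c')"
      unfolding J_def by (rule someI_ex[OF provable_cert[OF prov]])
    have "witness a X (0, 4, c) = Suc J" using prov by (simp only: witness_cert J_def if_True)
    moreover have "premise (decode c) J (decode c') \<longrightarrow> 0 < witness a X (0, 4, c')"
      using J by (auto simp: witness_cert simp del: split_paired_All)
    ultimately show "cert_ok (decode c) (witness a X (0, 4, c) - 1) \<and>
        (premise (decode c) (witness a X (0, 4, c) - 1) (decode c') \<longrightarrow> 0 < witness a X (0, 4, c'))"
      using J by simp
  qed
  ultimately show ?thesis by (simp add: tree_ok_def)
qed

section \<open>The upper bound\<close>

lemma cterm_val_app_seq:
  "cterm_val K2_eff (app_seq t X n) = app_val (cterm_val K2_eff t) X n"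
  by (induction n) (simp_all add: K2_eff_simps)

lemma app_seq_upd: "app_seq t (X(n := x)) (Suc n) = App (app_seq t X n) (Elem x)"
proof -
  have "app_seq t (X(n := x)) m = app_seq t X m" if "m \<le> n" for m
    using that by (induction m) auto
  then show ?thesis by simp
qed

text \<open>For a pair related at some stage, a path through \<open>diff_tree\<close> would give
  arguments on which the sides differ forever, against \<open>ex_sim_vals_eq\<close>. So the tree is
  well-founded, and its computable ranks bound the stage.\<close>

lemma sim_omega1_CK:
  assumes s: "s \<in> closed_terms K2_eff" and t: "t \<in> closed_terms K2_eff"
    and sim: "sim K2_eff \<gamma> s t"
  shows "sim K2_eff (omega1_CK :: (nat \<Rightarrow> nat) cterm ordinal) s t"
proof (cases "cterm_val K2_eff s = cterm_val K2_eff t")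
  case False
  define a where "a k = cterm_val K2_eff (if k = 0 then s else t)" for k :: nat
  have a: "computable f" if "a k = Some f" for k f
    using that s t cterm_val_K2_eff_computable by (auto simp: a_def split: if_splits)
  have path: "\<nexists>F. \<forall>n. map F [0..<n] \<in> diff_tree a"
  proof
    assume "\<exists>F. \<forall>n. map F [0..<n] \<in> diff_tree a"
    then obtain F where F: "\<And>n. map F [0..<n] \<in> diff_tree a" by blast
    obtain X where X: "\<And>i. computable (X i)" "\<And>i. app_val (a 0) X i \<noteq> app_val (a 1) X i"
      using diff_tree_path[OF F] by blast
    show False
      using ex_sim_vals_eq[OF sim, of X] X by (auto simp: K2_eff_simps cterm_val_app_seq a_def)
  qed
  have dec: "decidable (\<lambda>l. l \<in> diff_tree a)" using a by (rule decidable_diff_tree)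
  obtain rk :: "nat list \<Rightarrow> (nat \<Rightarrow> nat) cterm ordinal" where
    rk: "\<And>l. computable_ordinal (rk l)" "\<And>l m. l @ m \<in> diff_tree a \<Longrightarrow> m \<noteq> [] \<Longrightarrow> rk (l @ m) < rk l"
    by (rule computable_tree_rank[OF dec diff_tree_prefix path]) blast+
  define node where "node X n = map (\<lambda>p. witness a X (decode p)) [0..<Suc n]" for X n
  \<comment> \<open>\<open>osuc\<close> pays for one application, after which the values agree or
    the node has been extended and its rank is smaller.\<close>
  have main: "sim K2_eff (osuc (rk (node X n))) (app_seq s X n) (app_seq t X n)"
    if "\<And>j. j < n \<Longrightarrow> computable (X j)" "\<And>i. i \<le> n \<Longrightarrow> app_val (a 0) X i \<noteq> app_val (a 1) X i" for X n
    using that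
  proof (induction "rk (node X n)" arbitrary: X n rule: less_induct)
    case less
    have "sim K2_eff (rk (node X n)) (App (app_seq s X n) (Elem x)) (App (app_seq t X n) (Elem x))"
      if x: "computable x" for x
    proof -
      define Y where "Y = X(n := x)"
      have YX: "Y j = X j" if "j < n" for j using that by (simp add: Y_def)
      show ?thesis
      proof (cases "app_val (a 0) Y (Suc n) = app_val (a 1) Y (Suc n)")
        case True
        then have "cterm_val K2_eff (app_seq s Y (Suc n)) = cterm_val K2_eff (app_seq t Y (Suc n))"
          unfolding cterm_val_app_seq by (simp add: a_def)
        then show ?thesis unfolding Y_def app_seq_upd by (rule sim_eq)
      next
        case False
        have comp: "computable (Y j)" if "j < Suc n" for j
          using less.prems(1) x that by (auto simp: Y_def less_Suc_eq)
        have ne: "app_val (a 0) Y i \<noteq> app_val (a 1) Y i" if "i \<le> Suc n" for i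
        proof (cases "i = Suc n")
          case i: False
          have "app_val b Y i = app_val b X i" for b
            using i that by (intro app_val_cong YX) simp
          then show ?thesis using less.prems(2)[of i] i that by simp
        qed (use False in simp)
        have "node Y n = node X n"
          unfolding node_def
        proof (rule map_cong[OF refl])
          fix p assume "p \<in> set [0..<Suc n]"
          obtain i k c :: nat where p: "decode p = (i, k, c)" by (metis prod_cases3)
          then have "p = pos i k c" by (metis encode_decode pos_def)
          then have "i \<le> n" using le_pos[of i k c] \<open>p \<in> _\<close> by auto
          then show "witness a Y (decode p) = witness a X (decode p)"
            unfolding p by (intro witness_cong YX) simp
        qed
        then have split: "node Y (Suc n) = node X n @ [witness a Y (decode (Suc n))]"
          unfolding node_def by simp
        have "node Y (Suc n) \<in> diff_tree a"
          unfolding node_def diff_tree_map by (rule witness_tree_ok[OF comp ne])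
        then have lt: "rk (node Y (Suc n)) < rk (node X n)"
          unfolding split by (intro rk(2)) auto
        have "sim K2_eff (osuc (rk (node Y (Suc n)))) (app_seq s Y (Suc n)) (app_seq t Y (Suc n))"
          by (rule less.hyps[OF lt comp ne])
        then show ?thesis
          using lt unfolding osuc_le_iff[symmetric] Y_def app_seq_upd by (rule sim_mono)
      qed
    qed
    then show ?case by (simp add: sim_osuc K2_eff_simps)
  qed
  \<comment> \<open>No argument has been applied at the root, so any \<open>X\<close> will
    do.\<close>
  define X :: "nat \<Rightarrow> nat \<Rightarrow> nat" where "X = (\<lambda>_ _. 0)"
  have "sim K2_eff (osuc (rk (node X 0))) (app_seq s X 0) (app_seq t X 0)"
    by (rule main) (use False in \<open>auto simp: a_def\<close>)
  moreover have "osuc (rk (node X 0)) \<le> omega1_CK"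
    unfolding osuc_le_iff less_omega1_CK_iff by (rule rk(1))
  ultimately show ?thesis using sim_mono by fastforce
qed (rule sim_eq)

theorem theorem9p2:
  shows "pca_ord K2_eff = omega1_CK"
  unfolding pca_ord_def
proof (rule Least_equality)
  show "\<forall>s\<in>closed_terms K2_eff. \<forall>t\<in>closed_terms K2_eff.
      sim K2_eff (omega1_CK :: (nat \<Rightarrow> nat) cterm ordinal) s t \<longleftrightarrow> sim K2_eff (osuc (omega1_CK :: (nat \<Rightarrow> nat) cterm ordinal)) s t"
    using sim_omega1_CK sim_mono[OF _ less_imp_le[OF less_osuc]] by blast
next
  fix \<alpha> :: "(nat \<Rightarrow> nat) cterm ordinal"
  assume stable: "\<forall>s\<in>closed_terms K2_eff. \<forall>t\<in>closed_terms K2_eff.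
      sim K2_eff \<alpha> s t \<longleftrightarrow> sim K2_eff (osuc \<alpha>) s t"
  have "\<not> computable_ordinal \<alpha>"
    using computable_ordinal_strict stable by metis
  then show "omega1_CK \<le> \<alpha>"
    by (simp add: less_omega1_CK_iff flip: not_less)
qed

end
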